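(* Let $j>0$, $u\in L^\infty([0,1],\mathbb R_+)$ with $F(0;u)>0$, let $\delta>0$ with $j\delta<F(0;u)$ and let $\delta'=\delta/k$ with $k$ a positive integer. Then for every $m\in\mathbb N$ $$S^{(\delta,-)}_{m\delta}(u)\le S^{(\delta',-)}_{m\delta}(u)\le S^{(\delta',+)}_{m\delta}(u)\le S^{(\delta,+)}_{m\delta}(u).$$ Moreover, the maps $K^{(\delta)}$, $G^{\rm neum}_t*$ and $S^{(\delta,\pm)}_t$ preserve the order on $\mathcal U_\delta$ (i.e. $u\le v$ implies the same inequality between their images).
   Context: For a positive measure $\mu$ on $[0,1]$, $F(r;\mu)=\mu([r,1])$. $\mathcal U$ = measures $c_uD_0+\rho_u(r)dr$ with $c_u\ge0$, $\rho_u\in L^\infty([0,1],\mathbb R_+)$, $D_0$ the Dirac mass at $0$; $u\le v$ iff $F(r;u)\le F(r;v)$ for all $r\in[0,1]$. $\mathcal U_\delta=\{u\in\mathcal U:F(0;\rho_u)>j\delta\}$; $K^{(\delta)}u=j\delta D_0+\mathbf 1_{[0,R_\delta(u)]}u$ with $R_\delta(u)=\inf\{r:F(r;u)=j\delta\}$. $G^{\rm neum}_t(r,r')$ is the heat kernel of $\partial_t=\frac12\partial_r^2$ on $[0,1]$ with Neumann boundary conditions ($\sum_kG_t(r,r'_k)$, $G_t(r,r')=e^{-(r-r')^2/2t}/\sqrt{2\pi t}$, $r'_k$ the images of $r'$ under repeated reflections of $[0,1]$) and $G^{\rm neum}_t*\mu(r)=\int G^{\rm neum}_t(r,r')\mu(dr')$.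 Barriers: $S^{(\delta,\pm)}_0(u)=u$, $S^{(\delta,-)}_{n\delta}(u)=K^{(\delta)}G^{\rm neum}_\delta*S^{(\delta,-)}_{(n-1)\delta}(u)$, $S^{(\delta,+)}_{n\delta}(u)=G^{\rm neum}_\delta*K^{(\delta)}S^{(\delta,+)}_{(n-1)\delta}(u)$. *)

theory Defs
  imports "HOL-Analysis.Analysis"
begin

text \<open>A measure in the class U, c D_0 + rho(r) dr on [0,1], is represented by the pair (c, rho).\<close>
type_synonym umeas = "real \<times> (real \<Rightarrow> real)"

definition Linf_nonneg :: "(real \<Rightarrow> real) \<Rightarrow> bool" where
  "Linf_nonneg \<rho> \<longleftrightarrow>
     (\<lambda>r. indicator {0..1} r * \<rho> r) \<in> borel_measurable lebesgue \<and>
     (\<exists>B. \<forall>r\<in>{0..1}. 0 \<le> \<rho> r \<and> \<rho> r \<le> B)"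

definition in_U :: "umeas \<Rightarrow> bool" where
  "in_U u \<longleftrightarrow> 0 \<le> fst u \<and> Linf_nonneg (snd u)"

text \<open>F(r;u) = u([r,1]) for r in [0,1]; the Dirac mass at 0 counts only when r = 0.\<close>
definition Fm :: "umeas \<Rightarrow> real \<Rightarrow> real" where
  "Fm u r = (if r \<le> 0 then fst u else 0) + integral {r..1} (snd u)"

definition le_U :: "umeas \<Rightarrow> umeas \<Rightarrow> bool" where
  "le_U u v \<longleftrightarrow> (\<forall>r\<in>{0..1}. Fm u r \<le> Fm v r)"

definition in_U_delta :: "real \<Rightarrow> real \<Rightarrow> umeas \<Rightarrow> bool" where
  "in_U_delta j \<delta> u \<longleftrightarrow> in_U u \<and> Fm (0, snd u) 0 > j * \<delta>"

definition R_delta :: "real \<Rightarrow> real \<Rightarrow> umeas \<Rightarrow> real" where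
  "R_delta j \<delta> u = Inf {r \<in> {0..1}. Fm u r = j * \<delta>}"

text \<open>K^(delta) u = j delta D_0 + 1_[0,R_delta(u)] u  (the Dirac part of u at 0 lies in [0,R]).\<close>
definition K_delta :: "real \<Rightarrow> real \<Rightarrow> umeas \<Rightarrow> umeas" where
  "K_delta j \<delta> u = (j * \<delta> + fst u, (\<lambda>r. if 0 \<le> r \<and> r \<le> R_delta j \<delta> u then snd u r else 0))"

definition gauss :: "real \<Rightarrow> real \<Rightarrow> real \<Rightarrow> real" where
  "gauss t r r' = exp (- ((r - r')\<^sup>2) / (2 * t)) / sqrt (2 * pi * t)"

text \<open>Neumann heat kernel on [0,1]: sum over all reflection images r'+2k and 2k-r' (k in Z).\<close>
definition G_neum :: "real \<Rightarrow> real \<Rightarrow> real \<Rightarrow> real" where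
  "G_neum t r r' = infsum (\<lambda>k::int. gauss t r (r' + 2 * of_int k) + gauss t r (2 * of_int k - r')) UNIV"

text \<open>G^neum_t * mu, for mu = c D_0 + rho dr; the result is absolutely continuous.\<close>
definition heat :: "real \<Rightarrow> umeas \<Rightarrow> umeas" where
  "heat t u = (0, (\<lambda>r. fst u * G_neum t r 0 + integral {0..1} (\<lambda>r'. G_neum t r r' * snd u r')))"

primrec S_minus :: "real \<Rightarrow> real \<Rightarrow> umeas \<Rightarrow> nat \<Rightarrow> umeas" where
  "S_minus j \<delta> u 0 = u"
| "S_minus j \<delta> u (Suc n) = K_delta j \<delta> (heat \<delta> (S_minus j \<delta> u n))"

primrec S_plus :: "real \<Rightarrow> real \<Rightarrow> umeas \<Rightarrow> nat \<Rightarrow> umeas" where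
  "S_plus j \<delta> u 0 = u"
| "S_plus j \<delta> u (Suc n) = heat \<delta> (K_delta j \<delta> (S_plus j \<delta> u n))"

end

theory Submission
  imports Defs "HOL-Probability.Probability" "HOL-Real_Asymp.Real_Asymp"
begin

text \<open>
  By duality \<open>F(r; heat t u)\<close> is the integral against \<open>u\<close> of the Gaussian average of the indicator of
  \<open>[r, 1]\<close>, extended to an even 2-periodic function on the line; the reflection images of the Neumann
  kernel are absorbed in this extension. The heat flow is therefore order preserving as soon as
  Gaussian averages keep such a function nondecreasing on \<open>[0, 1]\<close>. Averages over windows of
  half-width at most 1 do, hence so does the Gaussian truncated to \<open>[-1, 1]\<close>; splitting time \<open>t\<close> into
  \<open>n\<close> steps, the truncation error is at most \<open>n\<close> times the mass outside \<open>[-1, 1]\<close> of the Gaussian of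
  variance \<open>t/n\<close>, which tends to \<open>0\<close>.

  The cut acts by \<open>F(r; K u) = max (F(r; u) - j \<delta>) 0\<close> for \<open>r > 0\<close> and keeps the total mass, so cuts are
  order preserving and add up. Cutting first and then diffusing gives more than diffusing first and
  then cutting, because the mass \<open>j \<delta>\<close> moved to \<open>0\<close> contributes at most \<open>j \<delta>\<close> to any \<open>F(r; .)\<close>.
  Commuting cuts and heat flows with this one inequality yields all the barrier comparisons.
\<close>

section \<open>Gaussian averages and monotone folded functions\<close>

lemma gauss_eq_normal_density: "gauss t x y = normal_density 0 (sqrt t) (x - y)" if "t > 0"
  using that by (simp add: gauss_def normal_density_def)

lemma gauss_nonneg [simp]: "t \<ge> 0 \<Longrightarrow> 0 \<le> gauss t x y"
  by (simp add: gauss_def)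

lemma gauss_cong_dist: "\<bar>x - y\<bar> = \<bar>x' - y'\<bar> \<Longrightarrow> gauss t x y = gauss t x' y'"
  unfolding gauss_def by (metis power2_abs)

lemma borel_measurable_gauss [measurable]:
  assumes [measurable]: "f \<in> borel_measurable M" "g \<in> borel_measurable M"
  shows "(\<lambda>w. gauss t (f w) (g w)) \<in> borel_measurable M"
  unfolding gauss_def by measurable

lemma nn_integral_gauss: "t > 0 \<Longrightarrow> (\<integral>\<^sup>+y. ennreal (gauss t x y) \<partial>lborel) = 1"
proof -
  assume t: "t > 0"
  have "(\<integral>\<^sup>+y. ennreal (gauss t x y) \<partial>lborel)
      = (\<integral>\<^sup>+y. ennreal (normal_density x (sqrt t) y) \<partial>lborel)"
    using t by (simp add: normal_density_def gauss_def power2_commute)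
  also have "\<dots> = 1"
    using t by (simp add: nn_integral_eq_integral normal_density_nonneg integrable_normal_density)
  finally show ?thesis .
qed

text \<open>Chapman-Kolmogorov identity: after a shift by \<open>z\<close> the integral is a
  convolution of two centred normal densities, whose variances add.\<close>

lemma nn_integral_gauss_gauss:
  assumes "s > 0" "t > 0"
  shows "(\<integral>\<^sup>+y. ennreal (gauss s x y) * ennreal (gauss t y z) \<partial>lborel) = ennreal (gauss (s + t) x z)"
proof -
  have "(\<integral>\<^sup>+y. ennreal (gauss s x y) * ennreal (gauss t y z) \<partial>lborel)
      = (\<integral>\<^sup>+y. ennreal (gauss s x (z + 1 * y)) * ennreal (gauss t (z + 1 * y) z) \<partial>lborel)"
    by (subst nn_integral_real_affine[where c = 1 and t = z]) simp_all
  also have "\<dots> = (\<integral>\<^sup>+y. ennreal (normal_density 0 (sqrt s) ((x - z) - y)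
      * normal_density 0 (sqrt t) y) \<partial>lborel)"
    using assms by (intro nn_integral_cong)
      (simp add: gauss_eq_normal_density ennreal_mult normal_density_nonneg algebra_simps)
  also have "\<dots> = ennreal (normal_density 0 (sqrt ((sqrt s)\<^sup>2 + (sqrt t)\<^sup>2)) (x - z))"
    using assms by (subst conv_normal_density_zero_mean[THEN fun_cong]) simp_all
  finally show ?thesis using assms by (simp add: gauss_eq_normal_density)
qed

text \<open>The heat semigroup of the whole line. Values in \<open>ennreal\<close> allow Tonelli and
  cancel all integrability side conditions.\<close>

definition heat_op :: "real \<Rightarrow> (real \<Rightarrow> ennreal) \<Rightarrow> real \<Rightarrow> ennreal" where
  "heat_op t f x = (\<integral>\<^sup>+y. ennreal (gauss t x y) * f y \<partial>lborel)"

lemma borel_measurable_heat_op [measurable]: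
  assumes [measurable]: "f \<in> borel_measurable borel"
  shows "heat_op t f \<in> borel_measurable borel"
  unfolding heat_op_def by measurable

lemma heat_op_mono: "(\<And>x. f x \<le> g x) \<Longrightarrow> heat_op t f x \<le> heat_op t g x"
  unfolding heat_op_def by (intro nn_integral_mono mult_left_mono) auto

lemma heat_op_const: "t > 0 \<Longrightarrow> heat_op t (\<lambda>_. c) x = c"
  unfolding heat_op_def by (simp add: nn_integral_multc nn_integral_gauss)

lemma heat_op_le_1: "t > 0 \<Longrightarrow> (\<And>x. f x \<le> 1) \<Longrightarrow> heat_op t f x \<le> 1"
  using heat_op_mono[of f "\<lambda>_. 1" t x] by (simp add: heat_op_const)

lemma heat_op_heat_op:
  assumes "s > 0" "t > 0" and [measurable]: "f \<in> borel_measurable borel"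
  shows "heat_op s (heat_op t f) x = heat_op (s + t) f x"
proof -
  have "heat_op s (heat_op t f) x
      = (\<integral>\<^sup>+y. \<integral>\<^sup>+z. ennreal (gauss s x y) * (ennreal (gauss t y z) * f z) \<partial>lborel \<partial>lborel)"
    unfolding heat_op_def by (subst nn_integral_cmult) auto
  also have "\<dots> = (\<integral>\<^sup>+z. \<integral>\<^sup>+y. ennreal (gauss s x y) * (ennreal (gauss t y z) * f z) \<partial>lborel \<partial>lborel)"
    by (rule lborel_pair.Fubini') measurable
  also have "\<dots> = (\<integral>\<^sup>+z. ennreal (gauss (s + t) x z) * f z \<partial>lborel)"
    using assms(1,2)
    by (simp add: mult.assoc[symmetric] nn_integral_multc nn_integral_gauss_gauss)
  finally show ?thesis unfolding heat_op_def .
qed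

section \<open>Folded functions and averages over symmetric windows\<close>

text \<open>Equivalent to: even, 2-periodic and nondecreasing on \<open>[0, 1]\<close>.\<close>

definition fold_mono :: "(real \<Rightarrow> ennreal) \<Rightarrow> bool" where
  "fold_mono f \<longleftrightarrow> (\<forall>x y. cos (pi * y) \<le> cos (pi * x) \<longrightarrow> f x \<le> f y)"

lemma fold_mono_cong: "fold_mono f \<Longrightarrow> cos (pi * x) = cos (pi * y) \<Longrightarrow> f x = f y"
  unfolding fold_mono_def by (metis antisym order_refl)

lemma fold_mono_minus: "fold_mono f \<Longrightarrow> f (- x) = f x"
  by (rule fold_mono_cong) auto

lemma cos_pi_add_even_int: "cos (pi * (x + 2 * of_int k)) = cos (pi * x)"
proof -
  have "cos (pi * (x + 2 * of_int k)) = cos (pi * x + 2 * pi * of_int k)"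
    by (simp add: algebra_simps)
  also have "\<dots> = cos (pi * x)" by (subst cos_add) (simp add: cos_int_2pin sin_int_2pin)
  finally show ?thesis .
qed

lemma fold_mono_add_even: "fold_mono f \<Longrightarrow> f (x + 2 * of_int k) = f x"
  by (rule fold_mono_cong) (simp_all add: cos_pi_add_even_int)

lemma fold_mono_le: "fold_mono f \<Longrightarrow> 0 \<le> x \<Longrightarrow> x \<le> y \<Longrightarrow> y \<le> 1 \<Longrightarrow> f x \<le> f y"
proof -
  assume *: "fold_mono f" "0 \<le> x" "x \<le> y" "y \<le> 1"
  have "cos (pi * y) \<le> cos (pi * x)"
    using * by (intro cos_monotone_0_pi_le) (auto simp: mult_left_le)
  with * show ?thesis unfolding fold_mono_def by blast
qed

text \<open>The difference \<open>cos (pi * (x - h)) - cos (pi * (x + h))\<close> is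
  \<open>2 * sin (pi * x) * sin (pi * h)\<close>, which is nonnegative for \<open>x\<close> and
  \<open>h\<close> in \<open>[0, 1]\<close>. This is where half-widths are limited to 1.\<close>

lemma fold_mono_reflect_le:
  assumes "fold_mono f" "0 \<le> x" "x \<le> 1" "0 \<le> h" "h \<le> 1"
  shows "f (x - h) \<le> f (x + h)"
proof -
  have "0 \<le> sin (pi * x) * sin (pi * h)"
    using assms by (intro mult_nonneg_nonneg sin_ge_zero) (auto simp: mult_left_le)
  hence "cos (pi * (x + h)) \<le> cos (pi * (x - h))"
    by (simp add: cos_add cos_diff distrib_left right_diff_distrib)
  with assms show ?thesis unfolding fold_mono_def by blast
qed

lemma ex_fold_representative:
  fixes x :: real
  obtains z n where "0 \<le> z" "z \<le> 1" "x = z + 2 * of_int n \<or> x = - z + 2 * of_int n"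
proof -
  \<comment> \<open>\<open>arccos\<close> inverts the folding: \<open>z\<close> is the point of
    \<open>[0, 1]\<close> with the same cosine as \<open>x\<close>.\<close>
  define z where "z = arccos (cos (pi * x)) / pi"
  have z: "0 \<le> z" "z \<le> 1"
    using arccos_bounded[of "cos (pi * x)"] by (auto simp: z_def)
  have "cos (pi * x) = cos (pi * z)" by (simp add: z_def)
  then obtain n where n: "n \<in> \<int>" "pi * x = pi * z + 2 * n * pi \<or> pi * x = - (pi * z) + 2 * n * pi"
    unfolding cos_eq by blast
  from n(2) have "pi * x = pi * (z + 2 * n) \<or> pi * x = pi * (- z + 2 * n)"
    by (auto simp: algebra_simps)
  hence "x = z + 2 * n \<or> x = - z + 2 * n"
    by (metis mult_cancel_left pi_neq_zero)
  with z that n(1) show thesis by (metis Ints_cases)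
qed

text \<open>Every point has a folded representative in \<open>[0, 1]\<close> with the same cosine
  and the same value of \<open>f\<close>, and on \<open>[0, 1]\<close> the cosine is
  decreasing.\<close>

lemma fold_monoI:
  assumes even: "\<And>x. f (- x) = f x" and per: "\<And>x k. f (x + 2 * of_int k) = f x"
    and mono: "\<And>x y. 0 \<le> x \<Longrightarrow> x \<le> y \<Longrightarrow> y \<le> 1 \<Longrightarrow> f x \<le> f y"
  shows "fold_mono f"
  unfolding fold_mono_def
proof safe
  fix x y :: real assume c: "cos (pi * y) \<le> cos (pi * x)"
  have *: "\<exists>z. 0 \<le> z \<and> z \<le> 1 \<and> cos (pi * w) = cos (pi * z) \<and> f w = f z" for w
  proof -
    obtain z n where z: "0 \<le> z" "z \<le> 1" "w = z + 2 * of_int n \<or> w = - z + 2 * of_int n"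
      by (rule ex_fold_representative)
    then have "cos (pi * w) = cos (pi * z) \<and> f w = f z"
      using cos_pi_add_even_int[of "- z" n] per[of "- z" n] by (auto simp: cos_pi_add_even_int per even)
    with z show ?thesis by blast
  qed
  obtain x' y' where z: "0 \<le> x'" "x' \<le> 1" "cos (pi * x) = cos (pi * x')" "f x = f x'"
    "0 \<le> y'" "y' \<le> 1" "cos (pi * y) = cos (pi * y')" "f y = f y'"
    using *[of x] *[of y] by blast
  have "pi * x' \<le> pi * y'"
    using c z cos_mono_le_eq[of "pi * y'" "pi * x'"] by (auto simp: mult_left_le)
  hence "x' \<le> y'" by simp
  with z mono show "f x \<le> f y" by simp
qed

text \<open>Moving the centre from \<open>x\<close> to \<open>y\<close> loses
  \<open>[x-h, y-h)\<close> and gains \<open>[x+h, y+h)\<close>. Pairing \<open>z - h\<close> with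
  \<open>z + h\<close> for \<open>z\<close> in \<open>[x, y)\<close>,
  \<open>fold_mono_reflect_le\<close> shows that the gain dominates the loss.\<close>

lemma nn_integral_window_mono:
  assumes f: "fold_mono f" and [measurable]: "f \<in> borel_measurable borel" and f1: "\<And>x. f x \<le> 1"
    and "0 \<le> x" "x \<le> y" "y \<le> 1" "0 \<le> h" "h \<le> 1"
  shows "(\<integral>\<^sup>+z. indicator {x-h..<x+h} z * f z \<partial>lborel) \<le> (\<integral>\<^sup>+z. indicator {y-h..<y+h} z * f z \<partial>lborel)"
proof -
  have shift: "(\<integral>\<^sup>+z. indicator {x+c..<y+c} z * f z \<partial>lborel)
      = (\<integral>\<^sup>+z. indicator {x..<y} z * f (z + c) \<partial>lborel)" for c
    by (subst nn_integral_real_affine[where c = 1 and t = c])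
       (auto intro!: nn_integral_cong split: split_indicator simp: add.commute)
  \<comment> \<open>Finiteness of the gained piece allows it to be cancelled in
    \<open>ennreal\<close> at the end.\<close>
  have fin: "(\<integral>\<^sup>+z. indicator {a..<b} z * f z \<partial>lborel) < \<infinity>" for a b
  proof -
    have "(\<integral>\<^sup>+z. indicator {a..<b} z * f z \<partial>lborel) \<le> (\<integral>\<^sup>+z. indicator {a..<b} z \<partial>lborel)"
      using f1 by (intro nn_integral_mono) (auto split: split_indicator)
    also have "\<dots> < \<infinity>" by (cases "a \<le> b") auto
    finally show ?thesis .
  qed
  have split: "(\<integral>\<^sup>+z. indicator {a..<c} z * f z \<partial>lborel)
      = (\<integral>\<^sup>+z. indicator {a..<b} z * f z \<partial>lborel) + (\<integral>\<^sup>+z. indicator {b..<c} z * f z \<partial>lborel)"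
    if "a \<le> b" "b \<le> c" for a b c
    using that by (subst nn_integral_add[symmetric])
      (auto intro!: nn_integral_cong split: split_indicator)
  have "(\<integral>\<^sup>+z. indicator {x-h..<y-h} z * f z \<partial>lborel) \<le> (\<integral>\<^sup>+z. indicator {x+h..<y+h} z * f z \<partial>lborel)"
    using assms fold_mono_reflect_le[OF f] shift[of "-h"] shift[of h]
    by (auto intro!: nn_integral_mono split: split_indicator)
  \<comment> \<open>Both sides are the integral over \<open>[x-h, y+h)\<close>, split at
    \<open>x+h\<close> and at \<open>y-h\<close>; half-open windows make the splittings
    exact.\<close>
  moreover have "(\<integral>\<^sup>+z. indicator {x-h..<x+h} z * f z \<partial>lborel) + (\<integral>\<^sup>+z. indicator {x+h..<y+h} z * f z \<partial>lborel)
      = (\<integral>\<^sup>+z. indicator {x-h..<y-h} z * f z \<partial>lborel) + (\<integral>\<^sup>+z. indicator {y-h..<y+h} z * f z \<partial>lborel)"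
    using assms by (simp add: split[symmetric])
  ultimately have "(\<integral>\<^sup>+z. indicator {x+h..<y+h} z * f z \<partial>lborel) + (\<integral>\<^sup>+z. indicator {x-h..<x+h} z * f z \<partial>lborel)
      \<le> (\<integral>\<^sup>+z. indicator {x+h..<y+h} z * f z \<partial>lborel) + (\<integral>\<^sup>+z. indicator {y-h..<y+h} z * f z \<partial>lborel)"
    by (simp add: add.commute add_right_mono)
  with fin[of "x+h" "y+h"] show ?thesis by (auto simp: ennreal_add_left_cancel_le)
qed

text \<open>The cut at half-width 1 is the largest that \<open>nn_integral_window_mono\<close>
  permits. The kernel is not renormalised, so that the operator stays below
  \<open>heat_op\<close>.\<close>

definition trunc_op :: "real \<Rightarrow> (real \<Rightarrow> ennreal) \<Rightarrow> real \<Rightarrow> ennreal" where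
  "trunc_op t f x = (\<integral>\<^sup>+y. indicator {-1..<1} y * ennreal (gauss t 0 y) * f (x + y) \<partial>lborel)"

lemma borel_measurable_trunc_op [measurable]:
  assumes [measurable]: "f \<in> borel_measurable borel"
  shows "trunc_op t f \<in> borel_measurable borel"
  unfolding trunc_op_def by measurable

lemma trunc_op_mono: "(\<And>x. f x \<le> g x) \<Longrightarrow> trunc_op t f x \<le> trunc_op t g x"
  unfolding trunc_op_def by (intro nn_integral_mono mult_left_mono) auto

section \<open>Comparison of truncated and full Gaussian averages\<close>

lemma heat_op_shift:
  assumes [measurable]: "f \<in> borel_measurable borel"
  shows "heat_op t f x = (\<integral>\<^sup>+y. ennreal (gauss t 0 y) * f (x + y) \<partial>lborel)"
  unfolding heat_op_def
  by (subst nn_integral_real_affine[where c = 1 and t = x])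
     (auto intro!: nn_integral_cong arg_cong2[where f = "(*)"] arg_cong[where f = ennreal] gauss_cong_dist)

lemma trunc_op_le_heat_op:
  assumes [measurable]: "f \<in> borel_measurable borel"
  shows "trunc_op t f x \<le> heat_op t f x"
  unfolding heat_op_shift[OF assms] trunc_op_def
  by (intro nn_integral_mono) (auto split: split_indicator)

text \<open>The truncated kernel has mass at most 1, so an error made in one time step is not
  amplified by the next ones.\<close>

lemma trunc_op_add_const_le:
  assumes [measurable]: "f \<in> borel_measurable borel" and t: "t > 0"
  shows "trunc_op t (\<lambda>x. f x + c) x \<le> trunc_op t f x + c"
proof -
  have "trunc_op t (\<lambda>x. f x + c) x = trunc_op t f x + trunc_op t (\<lambda>_. c) x"
    unfolding trunc_op_def by (simp add: distrib_left nn_integral_add)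
  also have "trunc_op t (\<lambda>_. c) x \<le> c"
    using trunc_op_le_heat_op[of "\<lambda>_. c" t x] heat_op_const[OF t] by simp
  finally show ?thesis by (simp add: add_left_mono)
qed

text \<open>Half of the exponent \<open>y^2 / (2 * t)\<close> is at least \<open>1 / (4 * t)\<close>
  when \<open>\<bar>y\<bar> \<ge> 1\<close>; the other half is the exponent of the Gaussian of
  variance \<open>2 * t\<close>. The factor \<open>sqrt 2\<close> adjusts the normalisation.\<close>

lemma gauss_tail_le:
  assumes t: "t > 0" and y: "1 \<le> \<bar>y\<bar>"
  shows "gauss t 0 y \<le> sqrt 2 * exp (- (1 / (4 * t))) * gauss (2 * t) 0 y"
proof -
  have "1 \<le> y\<^sup>2" using y by (metis one_power2 abs_ge_zero power2_abs power_mono zero_le_one)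
  hence "- (y\<^sup>2) / (2 * t) \<le> - (1 / (4 * t)) + - (y\<^sup>2) / (2 * (2 * t))"
    using t by (simp add: field_simps)
  hence "exp (- (y\<^sup>2) / (2 * t)) \<le> exp (- (1 / (4 * t))) * exp (- (y\<^sup>2) / (2 * (2 * t)))"
    by (simp add: exp_add[symmetric])
  hence "exp (- (y\<^sup>2) / (2 * t)) / sqrt (2 * pi * t)
      \<le> exp (- (1 / (4 * t))) * exp (- (y\<^sup>2) / (2 * (2 * t))) / sqrt (2 * pi * t)"
    using t by (intro divide_right_mono) auto
  also have "\<dots> = sqrt 2 * exp (- (1 / (4 * t))) * gauss (2 * t) 0 y"
    using t by (simp add: gauss_def real_sqrt_mult field_simps)
  finally show ?thesis by (simp add: gauss_def)
qed

text \<open>Since \<open>f \<le> 1\<close>, the loss is at most the Gaussian mass outside the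
  window; the tail bound integrates to the stated constant because the Gaussian of variance
  \<open>2 * t\<close> has mass 1.\<close>

lemma heat_op_le_trunc_op:
  assumes [measurable]: "f \<in> borel_measurable borel" and f1: "\<And>x. f x \<le> 1" and t: "t > 0"
  shows "heat_op t f x \<le> trunc_op t f x + ennreal (sqrt 2 * exp (- (1 / (4 * t))))"
proof -
  have "heat_op t f x \<le> (\<integral>\<^sup>+y. indicator {-1..<1} y * ennreal (gauss t 0 y) * f (x + y)
      + ennreal (sqrt 2 * exp (- (1 / (4 * t)))) * ennreal (gauss (2 * t) 0 y) \<partial>lborel)"
    unfolding heat_op_shift[OF assms(1)]
  proof (intro nn_integral_mono)
    fix y
    show "ennreal (gauss t 0 y) * f (x + y) \<le> indicator {-1..<1} y * ennreal (gauss t 0 y) * f (x + y)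
      + ennreal (sqrt 2 * exp (- (1 / (4 * t)))) * ennreal (gauss (2 * t) 0 y)"
    proof (cases "y \<in> {-1..<1}")
      case False
      hence "1 \<le> \<bar>y\<bar>" by auto
      have "ennreal (gauss t 0 y) * f (x + y) \<le> ennreal (gauss t 0 y) * 1"
        using f1 by (intro mult_left_mono) auto
      also have "\<dots> \<le> ennreal (sqrt 2 * exp (- (1 / (4 * t))) * gauss (2 * t) 0 y)"
        using gauss_tail_le[OF t \<open>1 \<le> \<bar>y\<bar>\<close>] by (simp add: ennreal_leI)
      finally show ?thesis using False t by (simp add: ennreal_mult)
    qed auto
  qed
  also have "\<dots> = trunc_op t f x + ennreal (sqrt 2 * exp (- (1 / (4 * t))))"
    unfolding trunc_op_def using t
    by (simp add: nn_integral_add nn_integral_cmult nn_integral_gauss)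
  finally show ?thesis .
qed

text \<open>A symmetric profile that decreases in \<open>\<bar>y\<bar>\<close> is a mixture of
  symmetric windows. The weight \<open>h / t * gauss t 0 h\<close> is minus the derivative of the
  Gaussian at \<open>h\<close>, integrated from \<open>\<bar>y\<bar>\<close> to 1.\<close>

lemma gauss_window_mixture:
  assumes t: "t > 0" and y: "y \<in> {-1..<1}"
  shows "ennreal (gauss t 0 y) = ennreal (gauss t 0 1)
    + (\<integral>\<^sup>+h. indicator {0..1} h * indicator {-h..<h} y * ennreal (h / t * gauss t 0 h) \<partial>lborel)"
proof -
  \<comment> \<open>For \<open>h = \<bar>y\<bar>\<close> the half-open window may or may not contain
    \<open>y\<close>, depending on its sign; this one value of \<open>h\<close> is
    discarded.\<close>
  have ae: "AE h in lborel. h \<noteq> \<bar>y\<bar>" by (rule AE_lborel_singleton)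
  have deriv: "((\<lambda>h. - gauss t 0 h) has_real_derivative (h / t * gauss t 0 h)) (at h)" for h
    unfolding gauss_def using t
    by (auto intro!: derivative_eq_intros simp: field_simps power2_eq_square)
  have "(\<integral>\<^sup>+h. indicator {0..1} h * indicator {-h..<h} y * ennreal (h / t * gauss t 0 h) \<partial>lborel)
      = (\<integral>\<^sup>+h. ennreal (h / t * gauss t 0 h) * indicator {\<bar>y\<bar>..1} h \<partial>lborel)"
    using ae y by (intro nn_integral_cong_AE) (auto elim!: eventually_mono split: split_indicator)
  also have "\<dots> = ennreal (- gauss t 0 1 - (- gauss t 0 \<bar>y\<bar>))"
  proof (rule nn_integral_FTC_Icc)
    show "(\<lambda>h. h / t * gauss t 0 h) \<in> borel_measurable borel" by measurable
    show "((\<lambda>h. - gauss t 0 h) has_real_derivative h / t * gauss t 0 h) (at h)" for h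
      by (rule deriv)
  qed (use t y in auto)
  also have "gauss t 0 \<bar>y\<bar> = gauss t 0 y" by (rule gauss_cong_dist) auto
  finally have "(\<integral>\<^sup>+h. indicator {0..1} h * indicator {-h..<h} y * ennreal (h / t * gauss t 0 h) \<partial>lborel)
      = ennreal (gauss t 0 y - gauss t 0 1)" by simp
  moreover have "gauss t 0 1 \<le> gauss t 0 y"
  proof -
    have "y\<^sup>2 \<le> 1" using y by (auto simp: abs_square_le_1)
    thus ?thesis using t by (auto simp: gauss_def intro!: divide_right_mono)
  qed
  ultimately show ?thesis using t by (simp add: ennreal_plus[symmetric] del: ennreal_plus)
qed

text \<open>By Tonelli the mixture for the kernel becomes a mixture of window integrals of
  \<open>f\<close>, each monotone in the centre \<open>x\<close>.\<close>

lemma trunc_op_window_mixture: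
  assumes t: "t > 0" and [measurable]: "f \<in> borel_measurable borel"
  shows "trunc_op t f x = ennreal (gauss t 0 1) * (\<integral>\<^sup>+z. indicator {x-1..<x+1} z * f z \<partial>lborel)
    + (\<integral>\<^sup>+h. indicator {0..1} h * ennreal (h / t * gauss t 0 h)
        * (\<integral>\<^sup>+z. indicator {x-h..<x+h} z * f z \<partial>lborel) \<partial>lborel)"
proof -
  have W: "(\<integral>\<^sup>+z. indicator {x-h..<x+h} z * f z \<partial>lborel) = (\<integral>\<^sup>+y. indicator {-h..<h} y * f (x + y) \<partial>lborel)" for h
    by (subst nn_integral_real_affine[where c = 1 and t = x])
       (auto intro!: nn_integral_cong split: split_indicator)
  have "trunc_op t f x = (\<integral>\<^sup>+y. ennreal (gauss t 0 1) * (indicator {-1..<1} y * f (x + y))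
    + (\<integral>\<^sup>+h. indicator {0..1} h * ennreal (h / t * gauss t 0 h) * (indicator {-h..<h} y * f (x + y)) \<partial>lborel) \<partial>lborel)"
    unfolding trunc_op_def
  proof (intro nn_integral_cong)
    fix y
    show "indicator {-1..<1} y * ennreal (gauss t 0 y) * f (x + y)
      = ennreal (gauss t 0 1) * (indicator {-1..<1} y * f (x + y))
      + (\<integral>\<^sup>+h. indicator {0..1} h * ennreal (h / t * gauss t 0 h) * (indicator {-h..<h} y * f (x + y)) \<partial>lborel)"
    proof (cases "y \<in> {-1..<1}")
      case True
      have [measurable]: "(\<lambda>h. indicator {- h..<h} y :: ennreal) \<in> borel_measurable borel"
        unfolding indicator_def by (simp; measurable)
      have "(\<integral>\<^sup>+h. indicator {0..1} h * ennreal (h / t * gauss t 0 h) * (indicator {-h..<h} y * f (x + y)) \<partial>lborel)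
        = (\<integral>\<^sup>+h. indicator {0..1} h * indicator {-h..<h} y * ennreal (h / t * gauss t 0 h) \<partial>lborel) * f (x + y)"
        by (subst nn_integral_multc[symmetric]) (auto intro!: nn_integral_cong simp: mult_ac)
      with True show ?thesis by (simp add: gauss_window_mixture[OF t True] distrib_right)
    next
      case False
      have "(\<integral>\<^sup>+h. indicator {0..1} h * ennreal (h / t * gauss t 0 h) * (indicator {-h..<h} y * f (x + y)) \<partial>lborel)
        = integral\<^sup>N lborel (\<lambda>h::real. 0)"
        using False by (intro nn_integral_cong) (auto split: split_indicator)
      with False show ?thesis by simp
    qed
  qed
  also have "\<dots> = ennreal (gauss t 0 1) * (\<integral>\<^sup>+y. indicator {-1..<1} y * f (x + y) \<partial>lborel)
    + (\<integral>\<^sup>+y. (\<integral>\<^sup>+h. indicator {0..1} h * ennreal (h / t * gauss t 0 h) * (indicator {-h..<h} y * f (x + y)) \<partial>lborel) \<partial>lborel)"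
    unfolding indicator_def by (subst nn_integral_add) (auto simp: nn_integral_cmult)
  also have "(\<integral>\<^sup>+y. (\<integral>\<^sup>+h. indicator {0..1} h * ennreal (h / t * gauss t 0 h) * (indicator {-h..<h} y * f (x + y)) \<partial>lborel) \<partial>lborel)
    = (\<integral>\<^sup>+h. (\<integral>\<^sup>+y. indicator {0..1} h * ennreal (h / t * gauss t 0 h) * (indicator {-h..<h} y * f (x + y)) \<partial>lborel) \<partial>lborel)"
    unfolding indicator_def by (rule lborel_pair.Fubini') simp
  also have "\<dots> = (\<integral>\<^sup>+h. indicator {0..1} h * ennreal (h / t * gauss t 0 h) * (\<integral>\<^sup>+y. indicator {-h..<h} y * f (x + y) \<partial>lborel) \<partial>lborel)"
    by (simp add: nn_integral_cmult)
  finally show ?thesis by (simp add: W[of 1] W)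
qed

text \<open>Evenness and periodicity are inherited from \<open>f\<close> and the symmetry of the
  kernel; monotonicity on \<open>[0, 1]\<close> holds window by window in the mixture.\<close>

lemma trunc_op_fold_mono:
  assumes t: "t > 0" and [measurable]: "f \<in> borel_measurable borel"
    and f: "fold_mono f" and f1: "\<And>x. f x \<le> 1"
  shows "fold_mono (trunc_op t f)"
proof (rule fold_monoI)
  fix x
  \<comment> \<open>Reflection turns \<open>[-1, 1)\<close> into \<open>(-1, 1]\<close>, so the two
    end points have to be discarded.\<close>
  have ae: "AE y in lborel. y \<noteq> (1::real)" "AE y in lborel. y \<noteq> (-1::real)"
    by (rule AE_lborel_singleton)+
  have "trunc_op t f (- x) = (\<integral>\<^sup>+y. indicator {-1..<1} (-y) * ennreal (gauss t 0 (-y)) * f (- x + (-y)) \<partial>lborel)"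
    unfolding trunc_op_def by (subst nn_integral_real_affine[where c = "-1" and t = 0]) auto
  also have "\<dots> = trunc_op t f x"
    unfolding trunc_op_def
  proof (rule nn_integral_cong_AE, use ae in eventually_elim)
    fix y :: real assume y: "y \<noteq> 1" "y \<noteq> - 1"
    have "gauss t 0 (- y) = gauss t 0 y" by (rule gauss_cong_dist) auto
    moreover have "f (- x + - y) = f (x + y)" using fold_mono_minus[OF f, of "x + y"] by simp
    ultimately show "indicator {-1..<1} (-y) * ennreal (gauss t 0 (-y)) * f (- x + (-y))
        = indicator {-1..<1} y * ennreal (gauss t 0 y) * f (x + y)"
      using y by (auto split: split_indicator)
  qed
  finally show "trunc_op t f (- x) = trunc_op t f x" .
next
  fix x and k :: int
  show "trunc_op t f (x + 2 * of_int k) = trunc_op t f x"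
  proof -
    have "f (x + 2 * of_int k + y) = f (x + y)" for y
      using fold_mono_add_even[OF f, of "x + y" k] by (simp add: add_ac)
    thus ?thesis unfolding trunc_op_def by simp
  qed
next
  fix x y :: real assume *: "0 \<le> x" "x \<le> y" "y \<le> 1"
  have "indicator {0..1} h * ennreal (h / t * gauss t 0 h) * (\<integral>\<^sup>+z. indicator {x-h..<x+h} z * f z \<partial>lborel)
     \<le> indicator {0..1} h * ennreal (h / t * gauss t 0 h) * (\<integral>\<^sup>+z. indicator {y-h..<y+h} z * f z \<partial>lborel)" for h
    using nn_integral_window_mono[OF f assms(2) f1 *, of h]
    by (auto split: split_indicator intro!: mult_left_mono)
  moreover have "(\<integral>\<^sup>+z. indicator {x-1..<x+1} z * f z \<partial>lborel) \<le> (\<integral>\<^sup>+z. indicator {y-1..<y+1} z * f z \<partial>lborel)"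
    using nn_integral_window_mono[OF f assms(2) f1 *, of 1] by simp
  ultimately show "trunc_op t f x \<le> trunc_op t f y"
    unfolding trunc_op_window_mixture[OF t assms(2)]
    by (intro add_mono nn_integral_mono) (auto intro: mult_left_mono)
qed

section \<open>Passage from truncated steps to the full heat semigroup\<close>

lemma heat_op_funpow:
  assumes s: "s > 0" and [measurable]: "f \<in> borel_measurable borel"
  shows "(heat_op s ^^ Suc n) f = heat_op (real (Suc n) * s) f"
proof (induction n)
  case (Suc n)
  have "(heat_op s ^^ Suc (Suc n)) f = heat_op s (heat_op (real (Suc n) * s) f)"
    using Suc by simp
  also have "\<dots> = heat_op (s + real (Suc n) * s) f"
    using s by (intro ext heat_op_heat_op) auto
  finally show ?case by (simp add: algebra_simps)
qed simp

lemma heat_op_fold_mono: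
  assumes t: "t > 0" and [measurable]: "f \<in> borel_measurable borel"
    and f: "fold_mono f" and f1: "\<And>x. f x \<le> 1"
  shows "fold_mono (heat_op t f)"
  unfolding fold_mono_def
proof safe
  fix x y :: real assume c: "cos (pi * y) \<le> cos (pi * x)"
  \<comment> \<open>The one-step truncation error from \<open>heat_op_le_trunc_op\<close>.\<close>
  define err where "err s = sqrt 2 * exp (- (1 / (4 * s)))" for s :: real
  have err0: "0 \<le> err s" for s by (simp add: err_def)
  have approx: "heat_op t f x \<le> heat_op t f y + ennreal (real (Suc n) * err (t / real (Suc n)))" for n
  proof -
    define s where "s = t / real (Suc n)"
    have s: "s > 0" using t by (simp add: s_def)
    define T where "T = (\<lambda>m. (trunc_op s ^^ m) f)"
    define H where "H = (\<lambda>m. (heat_op s ^^ m) f)"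
    have T_Suc: "T (Suc m) = trunc_op s (T m)" and H_Suc: "H (Suc m) = heat_op s (H m)" for m
      by (simp_all add: T_def H_def)
    have H: "H m \<in> borel_measurable borel \<and> (\<forall>x. H m x \<le> 1)" for m
    proof (induction m)
      case 0 thus ?case using f1 by (simp add: H_def)
    next
      case (Suc m) thus ?case using s by (auto simp: H_Suc intro!: heat_op_le_1)
    qed
    have T: "T m \<in> borel_measurable borel \<and> fold_mono (T m) \<and> (\<forall>x. T m x \<le> H m x)" for m
    proof (induction m)
      case 0 thus ?case using f by (simp add: T_def H_def)
    next
      case (Suc m)
      have "T (Suc m) x \<le> H (Suc m) x" for x
        unfolding T_Suc H_Suc
        by (rule order_trans[OF trunc_op_le_heat_op heat_op_mono]) (use Suc in auto)
      moreover have "T m x \<le> 1" for x using Suc H[of m] order_trans by blast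
      moreover have "fold_mono (T (Suc m))"
        unfolding T_Suc using Suc s \<open>\<And>x. T m x \<le> 1\<close> by (intro trunc_op_fold_mono) blast+
      moreover have "T (Suc m) \<in> borel_measurable borel"
        unfolding T_Suc using Suc by (intro borel_measurable_trunc_op) blast
      ultimately show ?case by blast
    qed
    \<comment> \<open>Errors add up: each step contributes one \<open>err s\<close>, and the
      accumulated error passes through \<open>trunc_op\<close> without growing.\<close>
    have HT: "H m x \<le> T m x + ennreal (real m * err s)" for m x
    proof (induction m arbitrary: x)
      case 0 thus ?case by (simp add: T_def H_def)
    next
      case (Suc m)
      have "H (Suc m) x \<le> trunc_op s (H m) x + ennreal (err s)"
        unfolding H_Suc err_def using H[of m] s by (intro heat_op_le_trunc_op) auto
      also have "trunc_op s (H m) x \<le> trunc_op s (\<lambda>x. T m x + ennreal (real m * err s)) x"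
        by (rule trunc_op_mono) (rule Suc)
      also have "\<dots> \<le> trunc_op s (T m) x + ennreal (real m * err s)"
        using T[of m] s by (intro trunc_op_add_const_le) auto
      also have "trunc_op s (T m) x + ennreal (real m * err s) + ennreal (err s)
          = T (Suc m) x + ennreal (real (Suc m) * err s)"
        using err0 by (simp add: T_Suc add.assoc ennreal_plus[symmetric] algebra_simps del: ennreal_plus)
      finally show ?case by (simp add: add_right_mono)
    qed
    have "H (Suc n) = heat_op t f"
      unfolding H_def heat_op_funpow[OF s assms(2)] by (simp add: s_def del: of_nat_Suc)
    moreover have "T (Suc n) x \<le> T (Suc n) y" using T[of "Suc n"] c unfolding fold_mono_def by blast
    moreover have "T (Suc n) y \<le> H (Suc n) y" using T[of "Suc n"] by blast
    ultimately have "T (Suc n) x \<le> heat_op t f y" by simp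
    hence "T (Suc n) x + ennreal (real (Suc n) * err s) \<le> heat_op t f y + ennreal (real (Suc n) * err s)"
      by (rule add_right_mono)
    with HT[of "Suc n" x] have "H (Suc n) x \<le> heat_op t f y + ennreal (real (Suc n) * err s)"
      by (rule order_trans)
    thus ?thesis unfolding \<open>H (Suc n) = heat_op t f\<close> s_def .
  qed
  \<comment> \<open>\<open>err (t / real (Suc n))\<close> is exponentially small in
    \<open>n\<close>, which beats the number of steps.\<close>
  have "(\<lambda>n. real (Suc n) * err (t / real (Suc n))) \<longlonglongrightarrow> 0"
    unfolding err_def using t by real_asymp
  hence "(\<lambda>n. heat_op t f y + ennreal (real (Suc n) * err (t / real (Suc n)))) \<longlonglongrightarrow> heat_op t f y + ennreal 0"
    by (intro tendsto_intros) 
  hence "(\<lambda>n. heat_op t f y + ennreal (real (Suc n) * err (t / real (Suc n)))) \<longlonglongrightarrow> heat_op t f y"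
    by simp
  thus "heat_op t f x \<le> heat_op t f y"
    by (rule LIMSEQ_le_const) (use approx in blast)
qed

section \<open>The Neumann kernel\<close>

text \<open>The integers are the union of two images of the naturals, each carrying a geometric
  series.\<close>

lemma integrable_count_space_int_geometric:
  fixes q :: real
  assumes "0 \<le> q" "q < 1"
  shows "integrable (count_space UNIV) (\<lambda>k::int. q ^ nat \<bar>k\<bar>)"
proof -
  let ?S = "Infinite_Set_Sum.abs_summable_on :: (int \<Rightarrow> real) \<Rightarrow> _"
  have nat: "Infinite_Set_Sum.abs_summable_on (\<lambda>n::nat. q ^ n) UNIV"
    using assms by (simp add: abs_summable_on_nat_iff' summable_geometric)
  have "?S (\<lambda>k. q ^ nat \<bar>k\<bar>) (range int)" "?S (\<lambda>k. q ^ nat \<bar>k\<bar>) (range (\<lambda>n. - int n))"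
    using nat by (subst abs_summable_on_reindex_iff[symmetric]; auto simp: inj_on_def)+
  hence "?S (\<lambda>k. q ^ nat \<bar>k\<bar>) (range int \<union> range (\<lambda>n. - int n))"
    by (rule abs_summable_on_union)
  moreover have "range int \<union> range (\<lambda>n. - int n) = UNIV"
    by (auto intro: int_cases2)
  ultimately show ?thesis unfolding Infinite_Set_Sum.abs_summable_on_def by simp
qed

text \<open>A geometric majorant in the image index, uniform over the points. The bound 2 on
  \<open>a\<close> covers both the differences \<open>y - x\<close> and the sums
  \<open>- y - x\<close> of points of \<open>[0, 1]\<close>.\<close>

lemma gauss_image_le:
  assumes t: "t > 0" and a: "\<bar>a\<bar> \<le> 2" and w: "\<bar>x - y\<bar> = \<bar>a + 2 * of_int k\<bar>"
  shows "gauss t x y \<le> exp (2 / t) / sqrt (2 * pi * t) * exp (- 1 / t) ^ nat \<bar>k\<bar>"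
proof -
  \<comment> \<open>With \<open>(a + 2k)^2 = 2(a + k)^2 + 2k^2 - a^2\<close>, these facts bound the
    squared distance below by \<open>2\<bar>k\<bar> - 4\<close>.\<close>
  have "0 \<le> (a + of_int k)\<^sup>2" by simp
  moreover have "a\<^sup>2 \<le> 4" using a power_mono[of "\<bar>a\<bar>" 2 2] by simp
  moreover have "\<bar>real_of_int k\<bar> \<le> (of_int k)\<^sup>2"
  proof (cases "k = 0")
    case False
    hence "1 \<le> \<bar>real_of_int k\<bar>" by linarith
    thus ?thesis using mult_right_mono[of 1 "\<bar>real_of_int k\<bar>" "\<bar>real_of_int k\<bar>"]
      by (simp add: power2_eq_square flip: abs_mult)
  qed simp
  moreover have "(x - y)\<^sup>2 = (a + 2 * of_int k)\<^sup>2" using w by (metis power2_abs)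
  ultimately have "2 * \<bar>real_of_int k\<bar> - 4 \<le> (x - y)\<^sup>2"
    by (simp add: power2_eq_square algebra_simps)
  hence "- ((x - y)\<^sup>2) / (2 * t) \<le> 2 / t + real (nat \<bar>k\<bar>) * (- 1 / t)"
    using t by (simp add: field_simps)
  hence "exp (- ((x - y)\<^sup>2) / (2 * t)) \<le> exp (2 / t) * exp (- 1 / t) ^ nat \<bar>k\<bar>"
    unfolding exp_of_nat_mult[symmetric] exp_add[symmetric] by simp
  thus ?thesis using t by (simp add: gauss_def divide_right_mono)
qed

text \<open>The summand of \<open>G_neum\<close>, named so that the sum over images can be treated
  as an integral over the counting measure on \<open>int\<close>.\<close>

definition theta_images :: "real \<Rightarrow> real \<Rightarrow> real \<Rightarrow> int \<Rightarrow> real" where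
  "theta_images t x y k = gauss t x (y + 2 * of_int k) + gauss t x (2 * of_int k - y)"

lemma theta_images_nonneg: "t > 0 \<Longrightarrow> 0 \<le> theta_images t x y k"
  by (simp add: theta_images_def)

lemma ex_theta_images_bound:
  assumes t: "t > 0"
  shows "\<exists>C\<ge>0. \<forall>x\<in>{0..1}. \<forall>y\<in>{0..1}. \<forall>k. theta_images t x y k \<le> C * exp (- 1 / t) ^ nat \<bar>k\<bar>"
proof -
  have "theta_images t x y k \<le> 2 * (exp (2 / t) / sqrt (2 * pi * t)) * exp (- 1 / t) ^ nat \<bar>k\<bar>"
    if "x \<in> {0..1}" "y \<in> {0..1}" for x y k
  proof -
    have "gauss t x (y + 2 * of_int k) \<le> exp (2 / t) / sqrt (2 * pi * t) * exp (- 1 / t) ^ nat \<bar>k\<bar>"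
      using that by (intro gauss_image_le[OF t, of "y - x"]) auto
    moreover have "gauss t x (2 * of_int k - y) \<le> exp (2 / t) / sqrt (2 * pi * t) * exp (- 1 / t) ^ nat \<bar>k\<bar>"
      using that by (intro gauss_image_le[OF t, of "- y - x"]) auto
    ultimately show ?thesis unfolding theta_images_def by simp
  qed
  moreover have "0 \<le> 2 * (exp (2 / t) / sqrt (2 * pi * t))" using t by simp
  ultimately show ?thesis by blast
qed

lemma integrable_theta_images:
  assumes t: "t > 0" and "x \<in> {0..1}" "y \<in> {0..1}"
  shows "integrable (count_space UNIV) (theta_images t x y)"
proof -
  obtain C where C: "C \<ge> 0" "\<forall>k. theta_images t x y k \<le> C * exp (- 1 / t) ^ nat \<bar>k\<bar>"
    using ex_theta_images_bound[OF t] assms by blast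
  have "integrable (count_space UNIV) (\<lambda>k::int. C * exp (- 1 / t) ^ nat \<bar>k\<bar>)"
    using t by (intro integrable_mult_right integrable_count_space_int_geometric) auto
  thus ?thesis
    by (rule Bochner_Integration.integrable_bound)
       (use C theta_images_nonneg[OF t] in \<open>auto simp: abs_of_nonneg\<close>)
qed

text \<open>Absolute summability identifies \<open>infsum\<close> with an integral, which later lets
  Tonelli exchange it with integrals in space.\<close>

lemma G_neum_eq_integral:
  assumes "t > 0" "x \<in> {0..1}" "y \<in> {0..1}"
  shows "G_neum t x y = integral\<^sup>L (count_space UNIV) (theta_images t x y)"
  using integrable_theta_images[OF assms]
  unfolding G_neum_def theta_images_def[symmetric] infsetsum_def[symmetric]
    Infinite_Set_Sum.abs_summable_on_def[symmetric]
  by (simp add: infsetsum_infsum)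

lemma ennreal_G_neum:
  assumes "t > 0" "x \<in> {0..1}" "y \<in> {0..1}"
  shows "ennreal (G_neum t x y) = (\<integral>\<^sup>+k. ennreal (theta_images t x y k) \<partial>count_space UNIV)"
  unfolding G_neum_eq_integral[OF assms] using assms
  by (subst nn_integral_eq_integral) (auto intro: integrable_theta_images theta_images_nonneg)

lemma G_neum_nonneg: "t > 0 \<Longrightarrow> x \<in> {0..1} \<Longrightarrow> y \<in> {0..1} \<Longrightarrow> 0 \<le> G_neum t x y"
  by (simp add: G_neum_eq_integral theta_images_nonneg)

lemma ex_G_neum_bound:
  assumes t: "t > 0"
  shows "\<exists>B. \<forall>x\<in>{0..1}. \<forall>y\<in>{0..1}. G_neum t x y \<le> B"
proof -
  obtain C where C: "C \<ge> 0"
    "\<forall>x\<in>{0..1}. \<forall>y\<in>{0..1}. \<forall>k. theta_images t x y k \<le> C * exp (- 1 / t) ^ nat \<bar>k\<bar>"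
    using ex_theta_images_bound[OF t] by blast
  have "integrable (count_space UNIV) (\<lambda>k::int. C * exp (- 1 / t) ^ nat \<bar>k\<bar>)"
    using t by (intro integrable_mult_right integrable_count_space_int_geometric) auto
  hence "G_neum t x y \<le> integral\<^sup>L (count_space UNIV) (\<lambda>k::int. C * exp (- 1 / t) ^ nat \<bar>k\<bar>)"
    if "x \<in> {0..1}" "y \<in> {0..1}" for x y
    using C that unfolding G_neum_eq_integral[OF t that]
    by (intro integral_mono integrable_theta_images[OF t]) auto
  thus ?thesis by blast
qed

text \<open>The images of \<open>[0, 1]\<close> tile the line: translations give the cells starting
  at even integers, reflections those starting at odd ones. Overlaps occur only at integers, a null
  set.\<close>

lemma nn_integral_image_cells:
  fixes f :: "real \<Rightarrow> ennreal"
  assumes [measurable]: "f \<in> borel_measurable borel"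
  shows "(\<integral>\<^sup>+k. (\<integral>\<^sup>+z. (indicator {- 2 * of_int k..1 - 2 * of_int k} z
      + indicator {2 * of_int k - 1..2 * of_int k} z) * f z \<partial>lborel) \<partial>count_space (UNIV :: int set))
    = (\<integral>\<^sup>+z. f z \<partial>lborel)"
proof -
  have "countable (\<int> :: real set)" by (simp add: Ints_def)
  hence ae: "AE z in lborel. z \<notin> (\<int> :: real set)"
    by (intro AE_not_in countable_imp_null_set_lborel)
  have one: "(\<integral>\<^sup>+k. indicator {- 2 * of_int k..1 - 2 * of_int k} z
      + indicator {2 * of_int k - 1..2 * of_int k} z \<partial>count_space (UNIV :: int set)) = (1 :: ennreal)"
    if "z \<notin> \<int>" for z :: real
  proof -
    \<comment> \<open>The index of the only cell containing \<open>z\<close>: a floor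
      \<open>- 2 * k\<close> belongs to a translate, a floor \<open>2 * k - 1\<close> to a reflected
      cell.\<close>
    define k0 where "k0 = (if even \<lfloor>z\<rfloor> then - (\<lfloor>z\<rfloor> div 2) else (\<lfloor>z\<rfloor> + 1) div 2)"
    have "indicator {- 2 * of_int k..1 - 2 * of_int k} z
      + indicator {2 * of_int k - 1..2 * of_int k} z = (indicator {k0} k :: ennreal)" for k :: int
    proof -
      have ne: "z \<noteq> of_int n" for n using that by auto
      have cell: "z \<in> {real_of_int n..of_int n + 1} \<longleftrightarrow> \<lfloor>z\<rfloor> = n" for n
        using ne[of "n + 1"] by (auto simp: floor_eq_iff less_le)
      have 1: "z \<in> {- 2 * real_of_int k..1 - 2 * of_int k} \<longleftrightarrow> \<lfloor>z\<rfloor> = - 2 * k"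
        using cell[of "- 2 * k"] by (simp add: add.commute)
      have 2: "z \<in> {2 * real_of_int k - 1..2 * of_int k} \<longleftrightarrow> \<lfloor>z\<rfloor> = 2 * k - 1"
        using cell[of "2 * k - 1"] by simp
      have "(\<lfloor>z\<rfloor> = - 2 * k \<or> \<lfloor>z\<rfloor> = 2 * k - 1) \<longleftrightarrow> k = k0"
        unfolding k0_def by presburger
      moreover have "\<not> (\<lfloor>z\<rfloor> = - 2 * k \<and> \<lfloor>z\<rfloor> = 2 * k - 1)" by presburger
      ultimately show ?thesis unfolding indicator_def 1 2 by auto
    qed
    thus ?thesis by simp
  qed
  have "(\<integral>\<^sup>+k. (\<integral>\<^sup>+z. (indicator {- 2 * of_int k..1 - 2 * of_int k} z
      + indicator {2 * of_int k - 1..2 * of_int k} z) * f z \<partial>lborel) \<partial>count_space (UNIV :: int set))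
    = (\<integral>\<^sup>+z. (\<integral>\<^sup>+k. (indicator {- 2 * of_int k..1 - 2 * of_int k} z
      + indicator {2 * of_int k - 1..2 * of_int k} z) * f z \<partial>count_space (UNIV :: int set)) \<partial>lborel)"
    by (rule nn_integral_count_space_nn_integral[symmetric]) auto
  also have "\<dots> = (\<integral>\<^sup>+z. f z \<partial>lborel)"
  proof (rule nn_integral_cong_AE, use ae in eventually_elim)
    fix z :: real assume z: "z \<notin> \<int>"
    have "(\<integral>\<^sup>+k. (indicator {- 2 * of_int k..1 - 2 * of_int k} z
      + indicator {2 * of_int k - 1..2 * of_int k} z) * f z \<partial>count_space (UNIV :: int set)) = 1 * f z"
      unfolding one[OF z, symmetric] by (rule nn_integral_multc) simp
    thus "(\<integral>\<^sup>+k. (indicator {- 2 * of_int k..1 - 2 * of_int k} z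
      + indicator {2 * of_int k - 1..2 * of_int k} z) * f z \<partial>count_space (UNIV :: int set)) = f z" by simp
  qed
  finally show ?thesis .
qed

text \<open>Unfolding: the substitutions \<open>x = 2k + z\<close> and \<open>x = 2k - z\<close>
  carry the images of \<open>y\<close> back to \<open>y\<close> and \<open>[0, 1]\<close> onto the
  cells of the tiling, while the symmetries of \<open>f\<close> leave its values unchanged.\<close>

lemma nn_integral_theta_images:
  fixes f :: "real \<Rightarrow> ennreal"
  assumes f: "fold_mono f" and [measurable]: "f \<in> borel_measurable borel" and t: "t > 0"
  shows "(\<integral>\<^sup>+x. indicator {0..1} x * f x * (\<integral>\<^sup>+k. ennreal (theta_images t x y k) \<partial>count_space UNIV) \<partial>lborel)
    = heat_op t f y"
proof -
  have "(\<integral>\<^sup>+x. indicator {0..1} x * f x * (\<integral>\<^sup>+k. ennreal (theta_images t x y k) \<partial>count_space UNIV) \<partial>lborel)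
    = (\<integral>\<^sup>+x. (\<integral>\<^sup>+k. indicator {0..1} x * f x * ennreal (theta_images t x y k) \<partial>count_space UNIV) \<partial>lborel)"
    by (simp add: nn_integral_cmult)
  also have "\<dots> = (\<integral>\<^sup>+k. (\<integral>\<^sup>+x. indicator {0..1} x * f x * ennreal (theta_images t x y k) \<partial>lborel) \<partial>count_space UNIV)"
    unfolding theta_images_def by (rule nn_integral_count_space_nn_integral) auto
  also have "\<dots> = (\<integral>\<^sup>+k. (\<integral>\<^sup>+z. (indicator {- 2 * of_int k..1 - 2 * of_int k} z
      + indicator {2 * of_int k - 1..2 * of_int k} z) * (ennreal (gauss t y z) * f z) \<partial>lborel)
      \<partial>count_space (UNIV :: int set))"
  proof (rule nn_integral_cong)
    fix k :: int
    have "(\<integral>\<^sup>+x. indicator {0..1} x * f x * ennreal (theta_images t x y k) \<partial>lborel)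
      = (\<integral>\<^sup>+x. indicator {0..1} x * f x * ennreal (gauss t x (y + 2 * of_int k)) \<partial>lborel)
      + (\<integral>\<^sup>+x. indicator {0..1} x * f x * ennreal (gauss t x (2 * of_int k - y)) \<partial>lborel)"
      using t by (subst nn_integral_add[symmetric]) (auto simp: theta_images_def distrib_left)
    also have "(\<integral>\<^sup>+x. indicator {0..1} x * f x * ennreal (gauss t x (y + 2 * of_int k)) \<partial>lborel)
      = (\<integral>\<^sup>+z. indicator {- 2 * of_int k..1 - 2 * of_int k} z * (ennreal (gauss t y z) * f z) \<partial>lborel)"
    proof (subst nn_integral_real_affine[where c = 1 and t = "2 * of_int k"], simp, simp,
        simp, rule nn_integral_cong)
      fix z
      have "gauss t (2 * of_int k + z) (y + 2 * of_int k) = gauss t y z"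
        by (rule gauss_cong_dist) auto
      moreover have "f (2 * of_int k + z) = f z"
        using fold_mono_add_even[OF f, of z k] by (simp add: add.commute)
      ultimately show "indicator {0..1} (2 * of_int k + z) * f (2 * of_int k + z)
          * ennreal (gauss t (2 * of_int k + z) (y + 2 * of_int k))
        = indicator {- (2 * of_int k)..1 - 2 * of_int k} z * (ennreal (gauss t y z) * f z)"
        by (auto split: split_indicator simp: mult.commute)
    qed
    also have "(\<integral>\<^sup>+x. indicator {0..1} x * f x * ennreal (gauss t x (2 * of_int k - y)) \<partial>lborel)
      = (\<integral>\<^sup>+z. indicator {2 * of_int k - 1..2 * of_int k} z * (ennreal (gauss t y z) * f z) \<partial>lborel)"
    proof (subst nn_integral_real_affine[where c = "-1" and t = "2 * of_int k"], simp, simp,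
        simp, rule nn_integral_cong)
      fix z
      have "gauss t (2 * of_int k - z) (2 * of_int k - y) = gauss t y z"
        by (rule gauss_cong_dist) auto
      moreover have "f (2 * of_int k - z) = f z"
        using fold_mono_add_even[OF f, of "- z" k] fold_mono_minus[OF f, of z] by (simp add: add.commute)
      ultimately show "indicator {0..1} (2 * of_int k - z) * f (2 * of_int k - z)
          * ennreal (gauss t (2 * of_int k - z) (2 * of_int k - y))
        = indicator {2 * of_int k - 1..2 * of_int k} z * (ennreal (gauss t y z) * f z)"
        by (auto split: split_indicator simp: mult.commute)
    qed
    finally show "(\<integral>\<^sup>+x. indicator {0..1} x * f x * ennreal (theta_images t x y k) \<partial>lborel)
      = (\<integral>\<^sup>+z. (indicator {- 2 * of_int k..1 - 2 * of_int k} z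
      + indicator {2 * of_int k - 1..2 * of_int k} z) * (ennreal (gauss t y z) * f z) \<partial>lborel)"
      by (simp add: distrib_right nn_integral_add)
  qed
  also have "\<dots> = heat_op t f y"
    unfolding heat_op_def by (rule nn_integral_image_cells) measurable
  finally show ?thesis .
qed

section \<open>Integration against a measure of class U\<close>

text \<open>The density is only Lebesgue measurable; \<open>nn_integral\<close> does not change under completion, so
  integrating over \<open>lborel\<close> is harmless.\<close>

definition pairing :: "umeas \<Rightarrow> (real \<Rightarrow> ennreal) \<Rightarrow> ennreal" where
  "pairing u f = ennreal (fst u) * f 0
    + (\<integral>\<^sup>+x. indicator {0..1} x * ennreal (snd u x) * f x \<partial>lborel)"

lemma pairing_cong: "(\<And>x. 0 \<le> x \<Longrightarrow> x \<le> 1 \<Longrightarrow> f x = g x) \<Longrightarrow> pairing u f = pairing u g"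
  unfolding pairing_def by (auto intro!: arg_cong2[where f = "(+)"] nn_integral_cong split: split_indicator)

text \<open>Bounded measurable functions are Lebesgue integrable on bounded intervals, so the gauge
  integral in the definitions agrees with \<open>nn_integral\<close>. Indicators are inserted
  because \<open>\<rho>\<close> is controlled only on \<open>[0, 1]\<close>.\<close>

lemma
  assumes "Linf_nonneg \<rho>" "0 \<le> a" "b \<le> 1"
  shows Linf_nonneg_integrable_on: "\<rho> integrable_on {a..b}"
    and ennreal_integral_Linf_nonneg:
      "ennreal (integral {a..b} \<rho>) = (\<integral>\<^sup>+x. indicator {a..b} x * ennreal (\<rho> x) \<partial>lborel)"
proof -
  obtain B where meas: "(\<lambda>r. indicator {0..1} r * \<rho> r) \<in> borel_measurable lebesgue"
    and B: "\<And>r. r \<in> {0..1} \<Longrightarrow> 0 \<le> \<rho> r \<and> \<rho> r \<le> B"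
    using assms(1) unfolding Linf_nonneg_def by blast
  have "(\<lambda>x. indicator {a..b} x *\<^sub>R \<rho> x) = (\<lambda>x. indicator {a..b} x * (indicator {0..1} x * \<rho> x))"
    using assms by (auto split: split_indicator)
  moreover have "(\<lambda>x. indicator {a..b} x * (indicator {0..1} x * \<rho> x)) \<in> borel_measurable lebesgue"
    by (rule borel_measurable_times[OF _ meas]) (auto intro!: borel_measurable_indicator)
  ultimately have m: "(\<lambda>x. indicator {a..b} x *\<^sub>R \<rho> x) \<in> borel_measurable lebesgue" by simp
  have "set_integrable lebesgue {a..b} \<rho>"
    unfolding set_integrable_def
  proof (rule Bochner_Integration.integrable_bound[OF _ m])
    show "integrable lebesgue (\<lambda>x. indicator {a..b} x * B)"
      by (intro integrable_mult_left integrable_completion[THEN iffD2] integrable_real_indicator)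
        (auto simp: emeasure_lborel_Icc_eq)
    have "norm (indicator {a..b} x *\<^sub>R \<rho> x) \<le> norm (indicator {a..b} x * B)" for x
      using B[of x] assms by (auto split: split_indicator)
    thus "AE x in lebesgue. norm (indicator {a..b} x *\<^sub>R \<rho> x) \<le> norm (indicator {a..b} x * B)"
      by simp
  qed
  from set_lebesgue_integral_eq_integral(1)[OF this] show i: "\<rho> integrable_on {a..b}" .
  have "(\<integral>\<^sup>+x. ennreal (indicator {a..b} x * \<rho> x) \<partial>lborel) = ennreal (integral {a..b} \<rho>)"
    using B assms i by (intro nn_integral_has_integral_lebesgue) auto
  moreover have "(\<integral>\<^sup>+x. ennreal (indicator {a..b} x * \<rho> x) \<partial>lborel)
      = (\<integral>\<^sup>+x. indicator {a..b} x * ennreal (\<rho> x) \<partial>lborel)"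
    by (intro nn_integral_cong) (auto split: split_indicator)
  ultimately show "ennreal (integral {a..b} \<rho>) = (\<integral>\<^sup>+x. indicator {a..b} x * ennreal (\<rho> x) \<partial>lborel)"
    by simp
qed

section \<open>Tails as pairings, and monotone test functions for the order\<close>

lemma integral_Linf_nonneg_nonneg: "Linf_nonneg \<rho> \<Longrightarrow> 0 \<le> a \<Longrightarrow> b \<le> 1 \<Longrightarrow> 0 \<le> integral {a..b} \<rho>"
  unfolding Linf_nonneg_def
  by (cases "integral {a..b} \<rho> = 0") (auto intro!: Henstock_Kurzweil_Integration.integral_nonneg not_integrable_integral dest: integral_unique)

lemma Fm_nonneg: "in_U u \<Longrightarrow> 0 \<le> r \<Longrightarrow> 0 \<le> Fm u r"
  unfolding in_U_def Fm_def by (auto intro!: add_nonneg_nonneg integral_Linf_nonneg_nonneg)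

lemma ennreal_Fm:
  assumes u: "in_U u" and r: "0 \<le> r" "r \<le> 1"
  shows "ennreal (Fm u r) = pairing u (indicator {r..})"
proof -
  have "ennreal (integral {r..1} (snd u)) = (\<integral>\<^sup>+x. indicator {0..1} x * ennreal (snd u x) * indicator {r..} x \<partial>lborel)"
    using u r unfolding in_U_def
    by (subst ennreal_integral_Linf_nonneg) (auto intro!: nn_integral_cong split: split_indicator)
  moreover have "0 \<le> integral {r..1} (snd u)"
    using u r unfolding in_U_def by (intro integral_Linf_nonneg_nonneg) auto
  ultimately show ?thesis using u r unfolding Fm_def pairing_def in_U_def by auto
qed

lemma le_U_iff_pairing:
  assumes "in_U u" "in_U v"
  shows "le_U u v \<longleftrightarrow> (\<forall>r\<in>{0..1}. pairing u (indicator {r..}) \<le> pairing v (indicator {r..}))"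
proof -
  have "Fm u r \<le> Fm v r \<longleftrightarrow> pairing u (indicator {r..}) \<le> pairing v (indicator {r..})"
    if "0 \<le> r" "r \<le> 1" for r
    unfolding ennreal_Fm[OF assms(1) that, symmetric] ennreal_Fm[OF assms(2) that, symmetric]
    by (rule ennreal_le_iff[symmetric]) (rule Fm_nonneg[OF assms(2) that(1)])
  thus ?thesis unfolding le_U_def by auto
qed

text \<open>Tonelli on products of \<open>lborel\<close> requires Borel measurability, so the
  Lebesgue measurable density is replaced by an almost everywhere equal Borel function.\<close>

lemma ex_borel_density:
  assumes "Linf_nonneg \<rho>"
  shows "\<exists>g\<in>borel_measurable borel. AE x in lborel. indicator {0..1} x * ennreal (\<rho> x) = g x"
proof -
  have "(\<lambda>r. indicator {0..1} r * \<rho> r) \<in> borel_measurable (completion lborel)"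
    using assms unfolding Linf_nonneg_def by blast
  then obtain g where g: "g \<in> borel_measurable lborel" "AE x in lborel. indicator {0..1} x * \<rho> x = g x"
    using completion_ex_borel_measurable_real by blast
  have "AE x in lborel. indicator {0..1} x * ennreal (\<rho> x) = ennreal (g x)"
    using g(2) by eventually_elim (auto split: split_indicator)
  with g(1) show ?thesis by (intro bexI[of _ "\<lambda>x. ennreal (g x)"]) auto
qed

lemma nn_integral_density_cong:
  assumes "AE x in lborel. indicator {0..1} x * ennreal (\<rho> x) = g x"
  shows "(\<integral>\<^sup>+x. indicator {0..1} x * ennreal (\<rho> x) * f x \<partial>lborel) = (\<integral>\<^sup>+x. g x * f x \<partial>lborel)"
  by (rule nn_integral_cong_AE, use assms in eventually_elim) simp

text \<open>Within \<open>[0, 1]\<close> an up-set is everything, empty, or a ray from its infimum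
  \<open>a\<close>, open or closed. The last case is reduced to closed rays by monotone
  convergence.\<close>

lemma pairing_indicator_upset_mono:
  assumes u: "in_U u" and v: "in_U v" and le: "le_U u v" and [measurable]: "A \<in> sets borel"
    and up: "\<And>x y. x \<in> A \<Longrightarrow> 0 \<le> x \<Longrightarrow> x \<le> y \<Longrightarrow> y \<le> 1 \<Longrightarrow> y \<in> A"
  shows "pairing u (indicator A) \<le> pairing v (indicator A)"
proof -
  \<comment> \<open>Thresholds above 1 are included because \<open>a + 1 / real (Suc n)\<close> may
    exceed 1 below.\<close>
  have Icc: "pairing u (indicator {r..}) \<le> pairing v (indicator {r..})" if "0 \<le> r" for r
  proof (cases "r \<le> 1")
    case True
    with that le le_U_iff_pairing[OF u v] show ?thesis by auto
  next
    case False
    hence "pairing u (indicator {r..}) = pairing u (\<lambda>_. 0)" by (intro pairing_cong) auto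
    also have "\<dots> = 0" by (simp add: pairing_def)
    finally show ?thesis by simp
  qed
  consider "0 \<in> A" | "A \<inter> {0..1} = {}" | "0 \<notin> A" "A \<inter> {0..1} \<noteq> {}" by blast
  thus ?thesis
  proof cases
    case 1
    hence "pairing w (indicator A) = pairing w (indicator {0..})" for w
      using up[of 0] by (intro pairing_cong) (auto split: split_indicator)
    thus ?thesis using Icc by simp
  next
    case 2
    hence "pairing u (indicator A) = pairing u (\<lambda>_. 0)" by (intro pairing_cong) (auto split: split_indicator)
    also have "\<dots> = 0" by (simp add: pairing_def)
    finally show ?thesis by simp
  next
    case 3
    define a where "a = Inf (A \<inter> {0..1})"
    have bdd: "bdd_below (A \<inter> {0..1})" by (auto intro: bdd_belowI[of _ 0])
    have a0: "0 \<le> a" unfolding a_def using 3 by (intro cInf_greatest) auto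
    have sub: "a \<le> x" if "x \<in> A" "0 \<le> x" "x \<le> 1" for x
      unfolding a_def using that bdd by (intro cInf_lower) auto
    have sup: "x \<in> A" if "a < x" "x \<le> 1" for x
    proof -
      have "\<exists>y\<in>A \<inter> {0..1}. y < x"
        using that(1) unfolding a_def cInf_less_iff[OF 3(2) bdd] .
      then obtain y where "y \<in> A \<inter> {0..1}" "y < x" ..
      thus ?thesis using up[of y x] that by auto
    qed
    have ae: "AE x in lborel. x \<noteq> a" by (rule AE_lborel_singleton)
    \<comment> \<open>Approximation from inside is essential when \<open>a = 0\<close>: the closed
      ray from 0 would count the Dirac mass, which \<open>A\<close> misses. For the density the end
      point \<open>a\<close> is null.\<close>
    have eq: "pairing w (indicator A) = (SUP n. pairing w (indicator {a + 1 / real (Suc n)..}))"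
      if w: "in_U w" for w
    proof -
      obtain g where [measurable]: "g \<in> borel_measurable borel"
        and g: "AE x in lborel. indicator {0..1} x * ennreal (snd w x) = g x"
        using ex_borel_density w unfolding in_U_def by blast
      have pw: "pairing w f = ennreal (fst w) * f 0 + (\<integral>\<^sup>+x. g x * f x \<partial>lborel)" for f
        unfolding pairing_def nn_integral_density_cong[OF g] ..
      have "pairing w (indicator A) = (\<integral>\<^sup>+x. indicator {0..1} x * ennreal (snd w x) * indicator A x \<partial>lborel)"
        using 3 by (simp add: pairing_def)
      also have "\<dots> = (\<integral>\<^sup>+x. indicator {0..1} x * ennreal (snd w x) * indicator {a<..} x \<partial>lborel)"
      proof (rule nn_integral_cong_AE, use ae in eventually_elim)
        fix x assume "x \<noteq> a"
        thus "indicator {0..1} x * ennreal (snd w x) * indicator A x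
            = indicator {0..1} x * ennreal (snd w x) * indicator {a<..} x"
          using sub[of x] sup[of x] by (auto split: split_indicator)
      qed
      also have "\<dots> = (\<integral>\<^sup>+x. g x * indicator {a<..} x \<partial>lborel)"
        by (rule nn_integral_density_cong[OF g])
      also have "\<dots> = (\<integral>\<^sup>+x. (SUP n. g x * indicator {a + 1 / real (Suc n)..} x) \<partial>lborel)"
      proof (rule nn_integral_cong)
        fix x
        have "indicator {a<..} x = (SUP n. indicator {a + 1 / real (Suc n)..} x :: ennreal)"
        proof (cases "a < x")
          case True
          then obtain n where n: "1 / real (Suc n) < x - a"
            using nat_approx_posE[of "x - a"] by auto
          have "(SUP n. indicator {a + 1 / real (Suc n)..} x :: ennreal) = 1"
          proof (rule antisym)
            show "(SUP n. indicator {a + 1 / real (Suc n)..} x :: ennreal) \<le> 1"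
              by (intro SUP_least) (auto split: split_indicator)
            show "1 \<le> (SUP n. indicator {a + 1 / real (Suc n)..} x :: ennreal)"
              using n by (intro SUP_upper2[of n]) auto
          qed
          with True show ?thesis by simp
        next
          case False
          have "indicator {a + 1 / real (Suc n)..} x = (0 :: ennreal)" for n
          proof -
            have "0 < 1 / real (Suc n)" by simp
            hence "\<not> a + 1 / real (Suc n) \<le> x" using False by linarith
            thus ?thesis by simp
          qed
          with False show ?thesis by simp
        qed
        thus "g x * indicator {a<..} x = (SUP n. g x * indicator {a + 1 / real (Suc n)..} x)"
          by (simp add: SUP_mult_left_ennreal)
      qed
      also have "\<dots> = (SUP n. \<integral>\<^sup>+x. g x * indicator {a + 1 / real (Suc n)..} x \<partial>lborel)"
      proof (rule nn_integral_monotone_convergence_SUP)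
        show "incseq (\<lambda>n x. g x * indicator {a + 1 / real (Suc n)..} x)"
        proof (intro incseq_SucI le_funI mult_left_mono)
          fix n x
          have "1 / real (Suc (Suc n)) \<le> 1 / real (Suc n)" by (intro divide_left_mono) auto
          thus "indicator {a + 1 / real (Suc n)..} x \<le> (indicator {a + 1 / real (Suc (Suc n))..} x :: ennreal)"
            by (auto split: split_indicator)
        qed simp
      qed measurable
      also have "\<dots> = (SUP n. pairing w (indicator {a + 1 / real (Suc n)..}))"
      proof (intro SUP_cong refl)
        fix n
        have "0 < a + 1 / real (Suc n)" using a0 by (intro add_nonneg_pos) auto
        thus "(\<integral>\<^sup>+x. g x * indicator {a + 1 / real (Suc n)..} x \<partial>lborel) = pairing w (indicator {a + 1 / real (Suc n)..})"
          unfolding pw by simp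
      qed
      finally show ?thesis .
    qed
    show ?thesis unfolding eq[OF u] eq[OF v] using a0 by (intro SUP_mono') (auto intro!: Icc)
  qed
qed

text \<open>Layer cake formula: \<open>f x\<close> is the length of the set of levels
  \<open>s \<ge> 0\<close> with \<open>s < f x\<close>, and Tonelli exchanges levels and
  points.\<close>

lemma pairing_layer_cake:
  assumes u: "in_U u" and [measurable]: "f \<in> borel_measurable borel" and f1: "\<And>x. f x \<le> 1"
  shows "pairing u f = (\<integral>\<^sup>+s. indicator {0..} s * pairing u (indicator {x. ennreal s < f x}) \<partial>lborel)"
proof -
  obtain g where [measurable]: "g \<in> borel_measurable borel"
    and g: "AE x in lborel. indicator {0..1} x * ennreal (snd u x) = g x"
    using ex_borel_density u unfolding in_U_def by blast
  have pu: "pairing u f = ennreal (fst u) * f 0 + (\<integral>\<^sup>+x. g x * f x \<partial>lborel)" for f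
    unfolding pairing_def nn_integral_density_cong[OF g] ..
  have [measurable]: "(\<lambda>(s, x). indicator {x. ennreal s < f x} x :: ennreal) \<in> borel_measurable (borel \<Otimes>\<^sub>M borel)"
    unfolding indicator_def by measurable
  have f: "f x = (\<integral>\<^sup>+s. indicator {0..} s * indicator {x. ennreal s < f x} x \<partial>lborel)" for x
  proof -
    obtain a where a: "f x = ennreal a" "0 \<le> a"
      using f1[of x] by (cases "f x") (auto simp: top_unique)
    have "(\<integral>\<^sup>+s. indicator {0..} s * indicator {x. ennreal s < f x} x \<partial>lborel) = (\<integral>\<^sup>+s. indicator {0..<a} s \<partial>lborel)"
      using a by (intro nn_integral_cong) (auto split: split_indicator simp: ennreal_less_iff)
    also have "\<dots> = f x" using a by simp
    finally show ?thesis ..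
  qed
  have "(\<integral>\<^sup>+x. g x * f x \<partial>lborel) = (\<integral>\<^sup>+x. (\<integral>\<^sup>+s. g x * (indicator {0..} s * indicator {x. ennreal s < f x} x) \<partial>lborel) \<partial>lborel)"
    by (subst f, subst nn_integral_cmult) auto
  also have "\<dots> = (\<integral>\<^sup>+s. (\<integral>\<^sup>+x. g x * (indicator {0..} s * indicator {x. ennreal s < f x} x) \<partial>lborel) \<partial>lborel)"
    by (rule lborel_pair.Fubini') measurable
  also have "\<dots> = (\<integral>\<^sup>+s. indicator {0..} s * (\<integral>\<^sup>+x. g x * indicator {x. ennreal s < f x} x \<partial>lborel) \<partial>lborel)"
    by (intro nn_integral_cong) (auto split: split_indicator)
  finally have 1: "(\<integral>\<^sup>+x. g x * f x \<partial>lborel) = (\<integral>\<^sup>+s. indicator {0..} s * (\<integral>\<^sup>+x. g x * indicator {x. ennreal s < f x} x \<partial>lborel) \<partial>lborel)" .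
  have "ennreal (fst u) * f 0 = (\<integral>\<^sup>+s. indicator {0..} s * (ennreal (fst u) * indicator {x. ennreal s < f x} 0) \<partial>lborel)"
    by (subst f, subst nn_integral_cmult[symmetric]) (auto intro!: nn_integral_cong simp: mult_ac)
  with 1 show ?thesis
    unfolding pu by (simp add: nn_integral_add[symmetric] distrib_left)
qed

text \<open>The superlevel sets of \<open>f\<close> are up-sets of \<open>[0, 1]\<close>, so the
  comparison holds level by level: stochastic dominance, tested against monotone functions.\<close>

lemma pairing_mono_le_U:
  assumes u: "in_U u" and v: "in_U v" and le: "le_U u v"
    and f: "fold_mono f" and [measurable]: "f \<in> borel_measurable borel" and f1: "\<And>x. f x \<le> 1"
  shows "pairing u f \<le> pairing v f"
  unfolding pairing_layer_cake[OF u assms(5) f1] pairing_layer_cake[OF v assms(5) f1]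
proof (intro nn_integral_mono mult_left_mono pairing_indicator_upset_mono[OF u v le])
  fix s x y assume "x \<in> {x. ennreal s < f x}" "0 \<le> x" "x \<le> y" "y \<le> 1"
  thus "y \<in> {x. ennreal s < f x}"
    using fold_mono_le[OF f, of x y] by (auto intro: less_le_trans)
qed auto

section \<open>The heat flow\<close>

lemma borel_measurable_theta_sum [measurable]:
  assumes [measurable]: "f \<in> borel_measurable M" "g \<in> borel_measurable M"
  shows "(\<lambda>w. \<integral>\<^sup>+k. ennreal (theta_images t (f w) (g w) k) \<partial>count_space UNIV) \<in> borel_measurable M"
proof -
  interpret sigma_finite_measure "count_space (UNIV :: int set)"
    by (rule sigma_finite_measure_count_space)
  have "(\<lambda>p. ennreal (theta_images t (f (snd p)) (g (snd p)) (fst p))) \<in> borel_measurable (count_space UNIV \<Otimes>\<^sub>M M)"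
    by (rule measurable_pair_measure_countable1) (auto simp: theta_images_def)
  hence "(\<lambda>(w, k). ennreal (theta_images t (f w) (g w) k)) \<in> borel_measurable (M \<Otimes>\<^sub>M count_space UNIV)"
    by (subst measurable_pair_swap_iff) (simp add: case_prod_beta)
  thus ?thesis by (rule borel_measurable_nn_integral)
qed

text \<open>The multiplier \<open>a'\<close> may differ from the Borel function \<open>a\<close> off
  \<open>[0, 1]\<close>. This suits \<open>G_neum\<close>, which is identified with a measurable
  image sum only there.\<close>

lemma Linf_nonneg_mult:
  assumes \<rho>: "Linf_nonneg \<rho>" and [measurable]: "a \<in> borel_measurable borel"
    and a: "\<And>x. x \<in> {0..1} \<Longrightarrow> 0 \<le> a' x \<and> a' x \<le> B \<and> a' x = a x"
  shows "Linf_nonneg (\<lambda>x. a' x * \<rho> x)"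
proof -
  obtain C where meas: "(\<lambda>r. indicator {0..1} r * \<rho> r) \<in> borel_measurable lebesgue"
    and C: "\<And>r. r \<in> {0..1} \<Longrightarrow> 0 \<le> \<rho> r \<and> \<rho> r \<le> C"
    using \<rho> unfolding Linf_nonneg_def by blast
  have "a \<in> borel_measurable lebesgue" by (intro measurable_completion) simp
  hence "(\<lambda>r. a r * (indicator {0..1} r * \<rho> r)) \<in> borel_measurable lebesgue"
    using meas by (rule borel_measurable_times)
  moreover have "(\<lambda>r. a r * (indicator {0..1} r * \<rho> r)) = (\<lambda>r. indicator {0..1} r * (a' r * \<rho> r))"
    using a by (auto split: split_indicator)
  moreover have "0 \<le> a' r * \<rho> r \<and> a' r * \<rho> r \<le> B * C" if "r \<in> {0..1}" for r
    using a[OF that] C[OF that] by (auto intro!: mult_mono)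
  ultimately show ?thesis unfolding Linf_nonneg_def by (auto intro!: exI[of _ "B * C"])
qed

text \<open>Brings the density of \<open>heat t u\<close> into a form fit for Tonelli, with the
  image sum in place of \<open>G_neum\<close>.\<close>

lemma ennreal_heat_density:
  assumes u: "in_U u" and t: "t > 0" and x: "x \<in> {0..1}"
  shows Linf_nonneg_G_neum_mult: "Linf_nonneg (\<lambda>y. G_neum t x y * snd u y)"
    and "ennreal (snd (heat t u) x) = ennreal (fst u) * (\<integral>\<^sup>+k. ennreal (theta_images t x 0 k) \<partial>count_space UNIV)
      + (\<integral>\<^sup>+y. indicator {0..1} y * ennreal (snd u y) * (\<integral>\<^sup>+k. ennreal (theta_images t x y k) \<partial>count_space UNIV) \<partial>lborel)"
    and "0 \<le> snd (heat t u) x"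
proof -
  obtain B where B: "\<And>x y. x \<in> {0..1} \<Longrightarrow> y \<in> {0..1} \<Longrightarrow> G_neum t x y \<le> B"
    using ex_G_neum_bound[OF t] by blast
  show L: "Linf_nonneg (\<lambda>y. G_neum t x y * snd u y)"
  proof (rule Linf_nonneg_mult)
    show "Linf_nonneg (snd u)" using u by (simp add: in_U_def)
    show "(\<lambda>y. enn2real (\<integral>\<^sup>+k. ennreal (theta_images t x y k) \<partial>count_space UNIV)) \<in> borel_measurable borel"
      by measurable
    show "0 \<le> G_neum t x y \<and> G_neum t x y \<le> B \<and> G_neum t x y
        = enn2real (\<integral>\<^sup>+k. ennreal (theta_images t x y k) \<partial>count_space UNIV)" if "y \<in> {0..1}" for y
      unfolding ennreal_G_neum[OF t x that, symmetric]
      using B[OF x that] G_neum_nonneg[OF t x that] by simp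
  qed
  have nn: "0 \<le> integral {0..1} (\<lambda>y. G_neum t x y * snd u y)"
    using L by (rule integral_Linf_nonneg_nonneg) auto
  have c: "0 \<le> fst u" "0 \<le> G_neum t x 0" using u G_neum_nonneg[OF t x, of 0] by (auto simp: in_U_def)
  thus "0 \<le> snd (heat t u) x" using nn by (simp add: heat_def)
  have "ennreal (integral {0..1} (\<lambda>y. G_neum t x y * snd u y))
      = (\<integral>\<^sup>+y. indicator {0..1} y * ennreal (G_neum t x y * snd u y) \<partial>lborel)"
    using L by (rule ennreal_integral_Linf_nonneg) auto
  also have "\<dots> = (\<integral>\<^sup>+y. indicator {0..1} y * ennreal (snd u y) * (\<integral>\<^sup>+k. ennreal (theta_images t x y k) \<partial>count_space UNIV) \<partial>lborel)"
  proof (rule nn_integral_cong)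
    fix y
    show "indicator {0..1} y * ennreal (G_neum t x y * snd u y)
      = indicator {0..1} y * ennreal (snd u y) * (\<integral>\<^sup>+k. ennreal (theta_images t x y k) \<partial>count_space UNIV)"
    proof (cases "y \<in> {0..1}")
      case True
      thus ?thesis using u unfolding ennreal_G_neum[OF t x True, symmetric]
        by (auto simp: in_U_def Linf_nonneg_def ennreal_mult G_neum_nonneg[OF t x True] mult.commute)
    qed auto
  qed
  finally show "ennreal (snd (heat t u) x) = ennreal (fst u) * (\<integral>\<^sup>+k. ennreal (theta_images t x 0 k) \<partial>count_space UNIV)
      + (\<integral>\<^sup>+y. indicator {0..1} y * ennreal (snd u y) * (\<integral>\<^sup>+k. ennreal (theta_images t x y k) \<partial>count_space UNIV) \<partial>lborel)"
    using c nn ennreal_G_neum[OF t x, of 0] by (simp add: heat_def ennreal_mult)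
qed

text \<open>The kernel is bounded on the unit square, hence so is the new density; its measurability
  is read off from a Borel version of the old one.\<close>

lemma in_U_heat:
  assumes u: "in_U u" and t: "t > 0"
  shows "in_U (heat t u)"
proof -
  obtain B where B: "\<And>x y. x \<in> {0..1} \<Longrightarrow> y \<in> {0..1} \<Longrightarrow> G_neum t x y \<le> B"
    using ex_G_neum_bound[OF t] by blast
  have "0 \<le> B" using B[of 0 0] G_neum_nonneg[OF t, of 0 0] by simp
  obtain C where C: "\<And>r. r \<in> {0..1} \<Longrightarrow> 0 \<le> snd u r \<and> snd u r \<le> C"
    using u unfolding in_U_def Linf_nonneg_def by blast
  have c: "0 \<le> fst u" using u by (simp add: in_U_def)
  obtain g where [measurable]: "g \<in> borel_measurable borel"
    and g: "AE x in lborel. indicator {0..1} x * ennreal (snd u x) = g x"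
    using ex_borel_density u unfolding in_U_def by blast
  define h where "h x = enn2real (ennreal (fst u) * (\<integral>\<^sup>+k. ennreal (theta_images t x 0 k) \<partial>count_space UNIV)
      + (\<integral>\<^sup>+y. g y * (\<integral>\<^sup>+k. ennreal (theta_images t x y k) \<partial>count_space UNIV) \<partial>lborel))" for x
  have [measurable]: "h \<in> borel_measurable borel" unfolding h_def by measurable
  have "snd (heat t u) x = h x" if "x \<in> {0..1}" for x
    using ennreal_heat_density[OF u t that]
    unfolding h_def nn_integral_density_cong[OF g, symmetric] by (metis enn2real_ennreal)
  hence "(\<lambda>x. indicator {0..1} x * snd (heat t u) x) = (\<lambda>x. indicator {0..1} x * h x)"
    by (auto split: split_indicator)
  moreover have "(\<lambda>x. indicator {0..1} x * h x) \<in> borel_measurable lebesgue"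
    by (intro measurable_completion) measurable
  moreover have "snd (heat t u) x \<le> fst u * B + B * C" if x: "x \<in> {0..1}" for x
  proof -
    have "integral {0..1} (\<lambda>y. G_neum t x y * snd u y) \<le> integral {0..1} (\<lambda>y::real. B * C)"
      using Linf_nonneg_G_neum_mult[OF u t x] C B[OF x] G_neum_nonneg[OF t x] \<open>0 \<le> B\<close>
      by (intro integral_le) (auto intro: Linf_nonneg_integrable_on intro!: mult_mono)
    thus ?thesis using c B[OF x, of 0] by (auto simp: heat_def intro!: add_mono mult_left_mono)
  qed
  ultimately show ?thesis
    using ennreal_heat_density(3)[OF u t] unfolding in_U_def Linf_nonneg_def
    by (auto simp: heat_def intro!: exI[of _ "fst u * B + B * C"])
qed

text \<open>Duality: Tonelli makes the Neumann kernel act on \<open>f\<close> instead of on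
  \<open>u\<close>, and on a folded \<open>f\<close> this action is the heat flow of the whole
  line.\<close>

lemma pairing_heat:
  assumes u: "in_U u" and t: "t > 0" and f: "fold_mono f" and [measurable]: "f \<in> borel_measurable borel"
  shows "pairing (heat t u) f = pairing u (heat_op t f)"
proof -
  define \<Theta> where "\<Theta> x y = (\<integral>\<^sup>+k. ennreal (theta_images t x y k) \<partial>count_space UNIV)" for x y
  have [measurable]: "case_prod \<Theta> \<in> borel_measurable (borel \<Otimes>\<^sub>M borel)"
    unfolding \<Theta>_def by measurable
  have \<Theta>: "(\<integral>\<^sup>+x. indicator {0..1} x * f x * \<Theta> x y \<partial>lborel) = heat_op t f y" for y
    unfolding \<Theta>_def by (rule nn_integral_theta_images[OF f _ t]) simp
  obtain g where [measurable]: "g \<in> borel_measurable borel"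
    and g: "AE x in lborel. indicator {0..1} x * ennreal (snd u x) = g x"
    using ex_borel_density u unfolding in_U_def by blast
  have "pairing (heat t u) f
      = (\<integral>\<^sup>+x. indicator {0..1} x * ennreal (snd (heat t u) x) * f x \<partial>lborel)"
    by (simp add: pairing_def heat_def)
  also have "\<dots> = (\<integral>\<^sup>+x. ennreal (fst u) * (indicator {0..1} x * f x * \<Theta> x 0)
      + (\<integral>\<^sup>+y. g y * (indicator {0..1} x * f x * \<Theta> x y) \<partial>lborel) \<partial>lborel)"
  proof (rule nn_integral_cong)
    fix x
    have "(\<integral>\<^sup>+y. g y * (indicator {0..1} x * f x * \<Theta> x y) \<partial>lborel) = indicator {0..1} x * f x * (\<integral>\<^sup>+y. g y * \<Theta> x y \<partial>lborel)"
      by (subst nn_integral_cmult[symmetric]) (auto intro!: nn_integral_cong simp: mult_ac)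
    thus "indicator {0..1} x * ennreal (snd (heat t u) x) * f x
      = ennreal (fst u) * (indicator {0..1} x * f x * \<Theta> x 0)
      + (\<integral>\<^sup>+y. g y * (indicator {0..1} x * f x * \<Theta> x y) \<partial>lborel)"
      using ennreal_heat_density(2)[OF u t, of x]
      unfolding \<Theta>_def[symmetric] nn_integral_density_cong[OF g]
      by (auto split: split_indicator simp: distrib_left distrib_right mult_ac)
  qed
  also have "\<dots> = ennreal (fst u) * heat_op t f 0
      + (\<integral>\<^sup>+x. (\<integral>\<^sup>+y. g y * (indicator {0..1} x * f x * \<Theta> x y) \<partial>lborel) \<partial>lborel)"
    by (simp add: nn_integral_add nn_integral_cmult \<Theta>)
  also have "(\<integral>\<^sup>+x. (\<integral>\<^sup>+y. g y * (indicator {0..1} x * f x * \<Theta> x y) \<partial>lborel) \<partial>lborel)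
      = (\<integral>\<^sup>+y. (\<integral>\<^sup>+x. g y * (indicator {0..1} x * f x * \<Theta> x y) \<partial>lborel) \<partial>lborel)"
    by (rule lborel_pair.Fubini') measurable
  also have "\<dots> = (\<integral>\<^sup>+y. g y * heat_op t f y \<partial>lborel)"
    by (simp add: nn_integral_cmult \<Theta>)
  finally show ?thesis unfolding pairing_def nn_integral_density_cong[OF g] .
qed

text \<open>For \<open>r\<close> in \<open>[0, 1]\<close>, the even 2-periodic extension of the
  indicator of \<open>[r, 1]\<close>; written with cosines, it is visibly
  \<open>fold_mono\<close>.\<close>

definition fold_step :: "real \<Rightarrow> real \<Rightarrow> ennreal" where
  "fold_step r = indicator {x. cos (pi * x) \<le> cos (pi * r)}"

lemma fold_step [simp, measurable]:
  "fold_step r \<in> borel_measurable borel" "fold_mono (fold_step r)" "fold_step r x \<le> 1"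
  unfolding fold_step_def by (auto simp: fold_mono_def split: split_indicator)

lemma fold_step_eq: "0 \<le> r \<Longrightarrow> r \<le> 1 \<Longrightarrow> 0 \<le> x \<Longrightarrow> x \<le> 1 \<Longrightarrow> fold_step r x = indicator {r..} x"
  unfolding fold_step_def
  by (auto split: split_indicator simp: cos_mono_le_eq mult_left_le)

lemma ennreal_Fm_fold_step:
  "in_U u \<Longrightarrow> 0 \<le> r \<Longrightarrow> r \<le> 1 \<Longrightarrow> ennreal (Fm u r) = pairing u (fold_step r)"
  using pairing_cong[of "fold_step r" "indicator {r..}" u] by (simp add: ennreal_Fm fold_step_eq)

lemma ennreal_Fm_heat:
  "in_U u \<Longrightarrow> t > 0 \<Longrightarrow> 0 \<le> r \<Longrightarrow> r \<le> 1 \<Longrightarrow> ennreal (Fm (heat t u) r) = pairing u (heat_op t (fold_step r))"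
  by (simp add: ennreal_Fm_fold_step in_U_heat pairing_heat)

text \<open>The Gaussian average of \<open>fold_step r\<close> is again monotone on
  \<open>[0, 1]\<close> and at most 1, hence an admissible test function for
  \<open>pairing_mono_le_U\<close>.\<close>

lemma heat_mono:
  assumes "in_U u" "in_U v" "le_U u v" "t > 0"
  shows "le_U (heat t u) (heat t v)"
proof -
  have "ennreal (Fm (heat t u) r) \<le> ennreal (Fm (heat t v) r)" if "0 \<le> r" "r \<le> 1" for r
    unfolding ennreal_Fm_heat[OF assms(1,4) that] ennreal_Fm_heat[OF assms(2,4) that]
    using assms by (intro pairing_mono_le_U heat_op_fold_mono heat_op_le_1) auto
  thus ?thesis using assms unfolding le_U_def by (auto simp: ennreal_le_iff Fm_nonneg in_U_heat)
qed

lemma Fm_heat_0: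
  assumes "in_U u" "t > 0"
  shows "Fm (heat t u) 0 = Fm u 0"
proof -
  have [simp]: "fold_step 0 = (\<lambda>_. 1)" by (auto simp: fold_step_def)
  have "ennreal (Fm (heat t u) 0) = ennreal (Fm u 0)"
    using assms by (subst ennreal_Fm_heat) (auto simp: ennreal_Fm_fold_step heat_op_const cong: pairing_cong)
  thus ?thesis using assms by (simp add: ennreal_inj Fm_nonneg in_U_heat)
qed

text \<open>The semigroup law, dual to \<open>heat_op_heat_op\<close>. It is stated for
  \<open>Fm\<close>, which is all that \<open>le_U\<close> sees.\<close>

lemma Fm_heat_heat:
  assumes "in_U u" "s > 0" "t > 0" "0 \<le> r" "r \<le> 1"
  shows "Fm (heat s (heat t u)) r = Fm (heat (s + t) u) r"
proof -
  have "pairing (heat t u) (heat_op s (fold_step r)) = pairing u (heat_op t (heat_op s (fold_step r)))"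
    using assms by (intro pairing_heat heat_op_fold_mono) auto
  also have "heat_op t (heat_op s (fold_step r)) = heat_op (s + t) (fold_step r)"
    using assms by (auto simp: heat_op_heat_op add.commute)
  finally have "ennreal (Fm (heat s (heat t u)) r) = ennreal (Fm (heat (s + t) u) r)"
    using assms by (simp add: ennreal_Fm_heat in_U_heat)
  thus ?thesis using assms by (simp add: ennreal_inj Fm_nonneg in_U_heat)
qed

section \<open>The cut and the barriers\<close>

lemma le_U_refl [simp]: "le_U u u" by (simp add: le_U_def)

lemma le_U_trans [trans]: "le_U u v \<Longrightarrow> le_U v w \<Longrightarrow> le_U u w"
  unfolding le_U_def by (meson order_trans)

lemma le_U_of_Fm_eq: "(\<And>r. 0 \<le> r \<Longrightarrow> r \<le> 1 \<Longrightarrow> Fm u r = Fm v r) \<Longrightarrow> le_U u v"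
  by (simp add: le_U_def)

lemma Fm_density_eq: "Fm (0, snd u) 0 = integral {0..1} (snd u)"
  by (simp add: Fm_def)

lemma Fm_0_eq: "Fm u 0 = fst u + Fm (0, snd u) 0"
  by (simp add: Fm_def)

text \<open>The tail of the density is continuous, starts above \<open>j * d\<close> and ends at 0,
  so the level is attained; the level set is closed and contains its infimum.\<close>

lemma R_delta_props:
  assumes u: "in_U_delta j d u" and jd: "0 < j * d"
  shows "0 < R_delta j d u" "R_delta j d u \<le> 1" "integral {R_delta j d u..1} (snd u) = j * d"
proof -
  define \<phi> where "\<phi> r = integral {r..1} (snd u)" for r
  have L: "Linf_nonneg (snd u)" and c: "0 \<le> fst u" and \<phi>0: "\<phi> 0 > j * d"
    using u by (auto simp: in_U_delta_def in_U_def Fm_density_eq \<phi>_def)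
  have cont: "continuous_on {0..1} \<phi>"
    unfolding \<phi>_def by (intro indefinite_integral_continuous_1' Linf_nonneg_integrable_on L) auto
  \<comment> \<open>At 0 both sides exceed \<open>j * d\<close>, so the Dirac mass does not affect
    the level set.\<close>
  have eq: "{r \<in> {0..1}. Fm u r = j * d} = {r \<in> {0..1}. \<phi> r = j * d}"
    using \<phi>0 c by (auto simp: Fm_def \<phi>_def)
  have "\<exists>r\<ge>0. r \<le> 1 \<and> \<phi> r = j * d"
    using \<phi>0 jd cont by (intro IVT2') (auto simp: \<phi>_def)
  hence ne: "{r \<in> {0..1}. \<phi> r = j * d} \<noteq> {}" by auto
  moreover have "closed {r \<in> {0..1}. \<phi> r = j * d}"
    using continuous_closed_preimage[OF cont, of "{j * d}"] by (simp add: vimage_def Int_def conj_commute)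
  ultimately have "R_delta j d u \<in> {r \<in> {0..1}. \<phi> r = j * d}"
    unfolding R_delta_def eq by (intro closed_contains_Inf) (auto intro: bdd_belowI[of _ 0])
  moreover have "R_delta j d u \<noteq> 0" using calculation \<phi>0 by auto
  ultimately show "0 < R_delta j d u" "R_delta j d u \<le> 1" "integral {R_delta j d u..1} (snd u) = j * d"
    by (auto simp: \<phi>_def)
qed

lemma in_U_K_delta:
  assumes "in_U u" "0 \<le> j * d"
  shows "in_U (K_delta j d u)"
proof -
  let ?R = "R_delta j d u"
  have "Linf_nonneg (\<lambda>x. indicator {0..?R} x * snd u x)"
    by (rule Linf_nonneg_mult[where B = 1 and a = "indicator {0..?R}"])
       (use assms in \<open>auto simp: in_U_def split: split_indicator\<close>)
  moreover have "(\<lambda>x. indicator {0..?R} x * snd u x) = (\<lambda>r. if 0 \<le> r \<and> r \<le> ?R then snd u r else 0)"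
    by (auto split: split_indicator)
  ultimately show ?thesis using assms by (auto simp: in_U_def K_delta_def)
qed

text \<open>To the left of \<open>R_delta\<close> the cut removes exactly the mass
  \<open>j * d\<close> of the part beyond it; to the right nothing is left, and the original tail
  was at most \<open>j * d\<close>.\<close>

lemma integral_K_delta:
  assumes u: "in_U_delta j d u" and jd: "0 < j * d" and r: "0 \<le> r" "r \<le> 1"
  shows "integral {r..1} (snd (K_delta j d u)) = max (integral {r..1} (snd u) - j * d) 0"
proof -
  let ?R = "R_delta j d u"
  note R = R_delta_props[OF u jd]
  have L: "Linf_nonneg (snd u)" using u by (auto simp: in_U_delta_def in_U_def)
  have "snd (K_delta j d u) = (\<lambda>x. if x \<in> {0..?R} then snd u x else 0)"
    by (auto simp: K_delta_def)
  hence K: "integral {r..1} (snd (K_delta j d u)) = integral ({r..1} \<inter> {0..?R}) (snd u)"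
    by (simp only: integral_restrict_Int Int_commute)
  show ?thesis
  proof (cases "r \<le> ?R")
    case True
    hence "{r..1} \<inter> {0..?R} = {r..?R}" using r R by auto
    hence "integral {r..1} (snd (K_delta j d u)) = integral {r..?R} (snd u)" by (simp only: K)
    moreover have "integral {r..?R} (snd u) + integral {?R..1} (snd u) = integral {r..1} (snd u)"
      using True R r by (intro Henstock_Kurzweil_Integration.integral_combine Linf_nonneg_integrable_on L) auto
    moreover have "0 \<le> integral {r..?R} (snd u)"
      using R r by (intro integral_Linf_nonneg_nonneg L) auto
    ultimately show ?thesis using R by simp
  next
    case False
    hence "{r..1} \<inter> {0..?R} = {}" by auto
    hence "integral {r..1} (snd (K_delta j d u)) = 0" by (simp only: K integral_empty)
    moreover have "integral {?R..r} (snd u) + integral {r..1} (snd u) = integral {?R..1} (snd u)"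
      using False R r by (intro Henstock_Kurzweil_Integration.integral_combine Linf_nonneg_integrable_on L) auto
    moreover have "0 \<le> integral {?R..r} (snd u)"
      using R r by (intro integral_Linf_nonneg_nonneg L) auto
    ultimately show ?thesis using R by simp
  qed
qed

text \<open>For \<open>r > 0\<close> the new Dirac mass is not counted; at \<open>r = 0\<close> it
  makes up exactly for the mass removed.\<close>

lemma
  assumes "in_U_delta j d u" "0 < j * d"
  shows Fm_K_delta: "0 < r \<Longrightarrow> r \<le> 1 \<Longrightarrow> Fm (K_delta j d u) r = max (Fm u r - j * d) 0"
    and Fm_K_delta_0: "Fm (K_delta j d u) 0 = Fm u 0"
    and Fm_density_K_delta: "Fm (0, snd (K_delta j d u)) 0 = Fm (0, snd u) 0 - j * d"
  using assms
  by (auto simp: Fm_def integral_K_delta in_U_delta_def) (simp add: K_delta_def)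

lemma K_delta_mono:
  assumes "in_U_delta j d u" "in_U_delta j d v" "0 < j * d" "le_U u v"
  shows "le_U (K_delta j d u) (K_delta j d v)"
  unfolding le_U_def
proof
  fix r :: real assume r: "r \<in> {0..1}"
  have "Fm u r \<le> Fm v r" using assms(4) r by (simp add: le_U_def)
  thus "Fm (K_delta j d u) r \<le> Fm (K_delta j d v) r"
    using r Fm_K_delta[OF assms(1,3), of r] Fm_K_delta[OF assms(2,3), of r]
      Fm_K_delta_0[OF assms(1,3)] Fm_K_delta_0[OF assms(2,3)]
    by (cases "r = 0") auto
qed

text \<open>The removed mass is \<open>j * d\<close>, and a test function bounded by 1 loses at most
  that much; the mass added at 0 can only help.\<close>

lemma pairing_le_pairing_K_delta:
  assumes u: "in_U_delta j d u" and jd: "0 < j * d"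
    and [measurable]: "f \<in> borel_measurable borel" and f1: "\<And>x. f x \<le> 1"
  shows "pairing u f \<le> pairing (K_delta j d u) f + ennreal (j * d)"
proof -
  let ?R = "R_delta j d u"
  note R = R_delta_props[OF u jd]
  have L: "Linf_nonneg (snd u)" and c: "0 \<le> fst u" using u by (auto simp: in_U_delta_def in_U_def)
  obtain g where [measurable]: "g \<in> borel_measurable borel"
    and g: "AE x in lborel. indicator {0..1} x * ennreal (snd u x) = g x"
    using ex_borel_density[OF L] by blast
  have gK: "AE x in lborel. indicator {0..1} x * ennreal (snd (K_delta j d u) x) = indicator {0..?R} x * g x"
    using g by eventually_elim (use R in \<open>auto simp: K_delta_def split: split_indicator split_indicator_asm\<close>)
  have "ennreal (j * d) = (\<integral>\<^sup>+x. indicator {?R..1} x * ennreal (snd u x) \<partial>lborel)"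
    using R L by (subst ennreal_integral_Linf_nonneg[symmetric]) auto
  also have "\<dots> = (\<integral>\<^sup>+x. indicator {?R..1} x * g x \<partial>lborel)"
    by (rule nn_integral_cong_AE, use g in eventually_elim)
       (use R in \<open>auto split: split_indicator split_indicator_asm\<close>)
  finally have a: "ennreal (j * d) = (\<integral>\<^sup>+x. indicator {?R..1} x * g x \<partial>lborel)" .
  have "(\<integral>\<^sup>+x. indicator {0..1} x * ennreal (snd u x) * f x \<partial>lborel)
    \<le> (\<integral>\<^sup>+x. indicator {0..?R} x * g x * f x + indicator {?R..1} x * g x \<partial>lborel)"
  proof (rule nn_integral_mono_AE, use g in eventually_elim)
    fix x assume gx: "indicator {0..1} x * ennreal (snd u x) = g x"
    have "g x * f x \<le> g x * 1" using f1 by (intro mult_left_mono) auto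
    thus "indicator {0..1} x * ennreal (snd u x) * f x
        \<le> indicator {0..?R} x * g x * f x + indicator {?R..1} x * g x"
      using R gx by (auto split: split_indicator split_indicator_asm)
  qed
  also have "\<dots> = (\<integral>\<^sup>+x. indicator {0..?R} x * g x * f x \<partial>lborel) + ennreal (j * d)"
    unfolding a by (rule nn_integral_add) measurable
  also have "(\<integral>\<^sup>+x. indicator {0..?R} x * g x * f x \<partial>lborel)
      = (\<integral>\<^sup>+x. indicator {0..1} x * ennreal (snd (K_delta j d u) x) * f x \<partial>lborel)"
    by (rule nn_integral_density_cong[OF gK, symmetric])
  finally have "(\<integral>\<^sup>+x. indicator {0..1} x * ennreal (snd u x) * f x \<partial>lborel)
    \<le> (\<integral>\<^sup>+x. indicator {0..1} x * ennreal (snd (K_delta j d u) x) * f x \<partial>lborel) + ennreal (j * d)" .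
  moreover have "ennreal (fst u) * f 0 \<le> ennreal (fst (K_delta j d u)) * f 0"
    using jd by (intro mult_right_mono ennreal_leI) (auto simp: K_delta_def)
  ultimately show ?thesis unfolding pairing_def by (simp add: add.assoc add_mono)
qed

section \<open>Exchanging cuts and heat flow, and composing cuts\<close>

lemma fst_heat [simp]: "fst (heat t u) = 0"
  by (simp add: heat_def)

lemma in_U_delta_in_U: "in_U_delta j d u \<Longrightarrow> in_U u"
  by (simp add: in_U_delta_def)

lemma in_U_delta_heat:
  "in_U u \<Longrightarrow> t > 0 \<Longrightarrow> j * d < Fm u 0 \<Longrightarrow> in_U_delta j d (heat t u)"
  using Fm_0_eq[of "heat t u"] by (simp add: in_U_delta_def in_U_heat Fm_heat_0)

lemma in_U_delta_Fm_0: "in_U_delta j d u \<Longrightarrow> j * d < Fm u 0"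
  using Fm_0_eq[of u] by (auto simp: in_U_delta_def in_U_def)

text \<open>At \<open>r = 0\<close> both sides carry the whole mass. For \<open>r > 0\<close> the
  cut subtracts \<open>j * a\<close> from the left tail, and cutting \<open>w\<close> before the
  flow lowers the tail by at most \<open>j * a\<close>, by duality and
  \<open>pairing_le_pairing_K_delta\<close>.\<close>

lemma K_delta_heat_le:
  assumes w: "in_U_delta j a w" and ja: "0 < j * a" and b: "0 < b"
  shows "le_U (K_delta j a (heat b w)) (heat b (K_delta j a w))"
  unfolding le_U_def
proof
  fix r :: real assume r: "r \<in> {0..1}"
  have U: "in_U w" "in_U (K_delta j a w)" "in_U_delta j a (heat b w)"
    using w ja b by (auto intro!: in_U_K_delta in_U_delta_heat in_U_delta_Fm_0 dest: in_U_delta_in_U)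
  show "Fm (K_delta j a (heat b w)) r \<le> Fm (heat b (K_delta j a w)) r"
  proof (cases "r = 0")
    case True
    thus ?thesis using U w ja b by (simp add: Fm_K_delta_0 Fm_heat_0)
  next
    case False
    have nn: "0 \<le> Fm (heat b (K_delta j a w)) r" using U b r by (intro Fm_nonneg in_U_heat) auto
    have "pairing w (heat_op b (fold_step r)) \<le> pairing (K_delta j a w) (heat_op b (fold_step r)) + ennreal (j * a)"
      using w ja b by (intro pairing_le_pairing_K_delta heat_op_le_1) auto
    hence "ennreal (Fm (heat b w) r) \<le> ennreal (Fm (heat b (K_delta j a w)) r + j * a)"
      using U b r ja nn by (simp add: ennreal_Fm_heat[symmetric] ennreal_plus)
    hence "Fm (heat b w) r \<le> Fm (heat b (K_delta j a w)) r + j * a"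
      using nn ja by (subst (asm) ennreal_le_iff) auto
    thus ?thesis using Fm_K_delta[OF U(3) ja, of r] nn r False by auto
  qed
qed

lemma in_U_delta_K_delta:
  assumes "in_U_delta j (a + b) u" "0 < j * a" "0 < j * b"
  shows "in_U_delta j a u" "in_U_delta j b (K_delta j a u)"
proof -
  show 1: "in_U_delta j a u" using assms by (auto simp: in_U_delta_def distrib_left)
  show "in_U_delta j b (K_delta j a u)"
    using assms Fm_density_K_delta[OF 1 assms(2)] by (auto simp: in_U_delta_def distrib_left in_U_K_delta)
qed

text \<open>Away from 0 this is
  \<open>max (max (x - j * a) 0 - j * b) 0 = max (x - j * (a + b)) 0\<close>; at 0 every cut keeps
  the mass.\<close>

lemma Fm_K_delta_K_delta:
  assumes u: "in_U_delta j (a + b) u" and ja: "0 < j * a" and jb: "0 < j * b" and r: "0 \<le> r" "r \<le> 1"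
  shows "Fm (K_delta j b (K_delta j a u)) r = Fm (K_delta j (a + b) u) r"
proof -
  note U = in_U_delta_K_delta[OF u ja jb]
  have jab: "0 < j * (a + b)" using ja jb by (simp add: distrib_left)
  show ?thesis
    using r Fm_K_delta[OF U(1) ja, of r] Fm_K_delta[OF U(2) jb, of r] Fm_K_delta[OF u jab, of r]
      Fm_K_delta_0[OF U(1) ja] Fm_K_delta_0[OF U(2) jb] Fm_K_delta_0[OF u jab]
    by (cases "r = 0") (use ja jb in \<open>auto simp: distrib_left\<close>)
qed

text \<open>Only the total mass is tracked: a step ends with a cut, which may leave too little mass
  in the density, but the next heat flow turns all mass into density before cutting again.\<close>

lemma S_minus_props:
  assumes "in_U u" "0 < j * d" "0 < d" "j * d < Fm u 0"
  shows "in_U (S_minus j d u n) \<and> Fm (S_minus j d u n) 0 = Fm u 0"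
  by (induction n) (use assms in \<open>auto simp: Fm_K_delta_0 in_U_delta_heat Fm_heat_0 intro!: in_U_K_delta in_U_heat\<close>)

text \<open>A step ends with the heat flow, after which the whole mass is density, so the next cut
  is admissible.\<close>

lemma S_plus_props:
  assumes "in_U_delta j d u" "0 < j * d" "0 < d"
  shows "in_U_delta j d (S_plus j d u n) \<and> Fm (S_plus j d u n) 0 = Fm u 0"
proof (induction n)
  case (Suc n)
  let ?K = "K_delta j d (S_plus j d u n)"
  have "in_U ?K" "Fm ?K 0 = Fm u 0"
    using Suc assms by (auto intro!: in_U_K_delta simp: Fm_K_delta_0 dest: in_U_delta_in_U)
  thus ?case using assms in_U_delta_Fm_0[OF assms(1)] by (auto intro!: in_U_delta_heat simp: Fm_heat_0)
qed (use assms in simp)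

text \<open>Allows a cut of size \<open>a\<close> other than the step \<open>d\<close>, as when a
  coarse cut is applied to the fine barrier.\<close>

lemma S_plus_in_U_delta:
  assumes "in_U_delta j d u" "0 < j * d" "0 < d" "in_U_delta j a u"
  shows "in_U_delta j a (S_plus j d u n)"
proof (cases n)
  case (Suc m)
  have "in_U_delta j d (S_plus j d u m)" "Fm (S_plus j d u m) 0 = Fm u 0"
    using S_plus_props[OF assms(1-3)] by auto
  hence "in_U (K_delta j d (S_plus j d u m))" "Fm (K_delta j d (S_plus j d u m)) 0 = Fm u 0"
    using assms by (auto intro!: in_U_K_delta simp: Fm_K_delta_0 dest: in_U_delta_in_U)
  thus ?thesis using assms Suc in_U_delta_Fm_0[OF assms(4)] by (auto intro!: in_U_delta_heat)
qed (use assms in simp)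

section \<open>Order preservation by the barriers, and lower against upper barriers\<close>

lemma K_delta_heat_mono:
  assumes "in_U u" "in_U v" "le_U u v" "0 < j * d" "0 < t" "j * d < Fm u 0" "j * d < Fm v 0"
  shows "le_U (K_delta j d (heat t u)) (K_delta j d (heat t v))"
  using assms by (intro K_delta_mono heat_mono in_U_delta_heat)

lemma heat_K_delta_mono:
  assumes "in_U_delta j d u" "in_U_delta j d v" "le_U u v" "0 < j * d" "0 < t"
  shows "le_U (heat t (K_delta j d u)) (heat t (K_delta j d v))"
  using assms by (intro K_delta_mono heat_mono in_U_K_delta) (auto dest: in_U_delta_in_U)

lemma S_minus_mono:
  assumes "in_U_delta j d u" "in_U_delta j d v" "0 < j * d" "0 < d" "le_U u v"
  shows "le_U (S_minus j d u n) (S_minus j d v n)"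
proof (induction n)
  case (Suc n)
  thus ?case
    using assms S_minus_props[OF in_U_delta_in_U[OF assms(1)] assms(3,4) in_U_delta_Fm_0[OF assms(1)], of n]
      S_minus_props[OF in_U_delta_in_U[OF assms(2)] assms(3,4) in_U_delta_Fm_0[OF assms(2)], of n]
      in_U_delta_Fm_0[OF assms(1)] in_U_delta_Fm_0[OF assms(2)]
    by (auto intro!: K_delta_heat_mono)
qed (use assms in simp)

lemma S_plus_mono:
  assumes "in_U_delta j d u" "in_U_delta j d v" "0 < j * d" "0 < d" "le_U u v"
  shows "le_U (S_plus j d u n) (S_plus j d v n)"
proof (induction n)
  case (Suc n)
  thus ?case
    using assms S_plus_props[of j d u n] S_plus_props[of j d v n]
    by (auto intro!: heat_K_delta_mono)
qed (use assms in simp)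

text \<open>Each step carries the order through the flow and the cut, then exchanges the two by
  \<open>K_delta_heat_le\<close>.\<close>

lemma S_minus_le_S_plus:
  assumes u: "in_U_delta j d u" and jd: "0 < j * d" and d: "0 < d"
  shows "le_U (S_minus j d u n) (S_plus j d u n)"
proof (induction n)
  case (Suc n)
  have m: "in_U (S_minus j d u n)" "j * d < Fm (S_minus j d u n) 0"
    using S_minus_props[OF in_U_delta_in_U[OF u] jd d in_U_delta_Fm_0[OF u], of n] in_U_delta_Fm_0[OF u] by auto
  have p: "in_U_delta j d (S_plus j d u n)" using S_plus_props[OF assms] by blast
  have "le_U (K_delta j d (heat d (S_minus j d u n))) (K_delta j d (heat d (S_plus j d u n)))"
    using Suc m p jd d in_U_delta_Fm_0[OF p] by (intro K_delta_heat_mono) (auto dest: in_U_delta_in_U)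
  also have "le_U \<dots> (heat d (K_delta j d (S_plus j d u n)))"
    by (rule K_delta_heat_le[OF p jd d])
  finally show ?case by simp
qed simp

section \<open>Refinement of the time step\<close>

lemma S_minus_add: "S_minus j d u (m + n) = S_minus j d (S_minus j d u m) n"
  by (induction n) auto

lemma S_plus_add: "S_plus j d u (m + n) = S_plus j d (S_plus j d u m) n"
  by (induction n) auto

text \<open>One coarse step against \<open>Suc n\<close> fine ones from the same measure. The last
  fine step is split off the coarse flow and the coarse cut. Counting from \<open>Suc n\<close>
  avoids \<open>heat 0\<close>, whose kernel is 0 by the convention for division by zero.\<close>

lemma K_delta_heat_le_S_minus:
  assumes j: "0 < j" and e: "0 < e" and v: "in_U v" and M: "j * (real (Suc n) * e) < Fm v 0"
  shows "le_U (K_delta j (real (Suc n) * e) (heat (real (Suc n) * e) v)) (S_minus j e v (Suc n))"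
  using M
proof (induction n)
  case (Suc n)
  define a where "a = real (Suc n) * e"
  have pos: "0 < a" "0 < j * a" "0 < j * e" using j e by (auto simp: a_def)
  have sum: "real (Suc (Suc n)) * e = a + e" by (simp add: a_def algebra_simps)
  have M: "j * (a + e) < Fm v 0" using Suc.prems unfolding sum .
  have M': "j * a < Fm v 0" "j * e < Fm v 0" using M pos by (auto simp: distrib_left)
  have IH: "le_U (K_delta j a (heat a v)) (S_minus j e v (Suc n))"
    using Suc.IH M' unfolding a_def by blast
  define w where "w = heat a v"
  have w: "in_U_delta j (a + e) w" "in_U_delta j a w" "in_U w" "Fm w 0 = Fm v 0"
    using M M' pos v by (auto simp: w_def in_U_delta_heat in_U_heat Fm_heat_0)
  have ew: "in_U_delta j (a + e) (heat e w)" "in_U_delta j a (heat e w)"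
    using w M M' e by (auto intro!: in_U_delta_heat)
  have Kw: "in_U (K_delta j a w)" "Fm (K_delta j a w) 0 = Fm v 0"
    using w pos by (auto simp: in_U_K_delta Fm_K_delta_0)
  have "le_U (K_delta j (a + e) (heat (a + e) v)) (K_delta j (a + e) (heat e w))"
  proof (rule K_delta_mono)
    show "le_U (heat (a + e) v) (heat e w)"
      unfolding w_def by (rule le_U_of_Fm_eq) (use v e pos in \<open>simp add: Fm_heat_heat add.commute\<close>)
  qed (use v e pos M ew in \<open>auto intro!: in_U_delta_heat simp: distrib_left\<close>)
  also have "le_U \<dots> (K_delta j e (K_delta j a (heat e w)))"
    by (rule le_U_of_Fm_eq) (use ew pos in \<open>simp add: Fm_K_delta_K_delta\<close>)
  \<comment> \<open>The cut of size \<open>a\<close> is moved before the last heat flow of length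
    \<open>e\<close>.\<close>
  also have "le_U \<dots> (K_delta j e (heat e (K_delta j a w)))"
    using ew w Kw pos e M M'
    by (intro K_delta_mono K_delta_heat_le in_U_delta_heat in_U_delta_K_delta(2)) auto
  also have "le_U \<dots> (K_delta j e (heat e (S_minus j e v (Suc n))))"
    using IH Kw S_minus_props[of v j e "Suc n"] v pos e M' unfolding w_def
    by (intro K_delta_heat_mono) auto
  finally show ?case unfolding sum by simp
qed simp

text \<open>The mirror image for upper barriers: after the induction hypothesis, the last fine cut
  is moved before the flow over time \<open>a\<close>, and flows and cuts are merged.\<close>

lemma S_plus_le_heat_K_delta:
  assumes j: "0 < j" and e: "0 < e" and v: "in_U_delta j (real (Suc n) * e) v"
  shows "le_U (S_plus j e v (Suc n)) (heat (real (Suc n) * e) (K_delta j (real (Suc n) * e) v))"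
  using v
proof (induction n)
  case (Suc n)
  define a where "a = real (Suc n) * e"
  have pos: "0 < a" "0 < j * a" "0 < j * e" "0 < j * (a + e)"
    using j e by (auto simp: a_def add_pos_pos)
  have sum: "real (Suc (Suc n)) * e = a + e" by (simp add: a_def algebra_simps)
  have v: "in_U_delta j (a + e) v" using Suc.prems unfolding sum .
  note va = in_U_delta_K_delta[OF v pos(2,3)]
  have ve: "in_U_delta j e v" by (rule in_U_delta_K_delta(1)[of _ _ a]) (use v pos in \<open>auto simp: add.commute\<close>)
  have IH: "le_U (S_plus j e v (Suc n)) (heat a (K_delta j a v))"
    using Suc.IH va(1) unfolding a_def by blast
  have U: "in_U v" "in_U (K_delta j a v)" "in_U (K_delta j e (K_delta j a v))" "in_U (K_delta j (a + e) v)"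
    using v va pos by (auto intro!: in_U_K_delta dest: in_U_delta_in_U)
  have Qa: "in_U_delta j e (heat a (K_delta j a v))"
    using U va pos by (auto intro!: in_U_delta_heat dest: in_U_delta_Fm_0)
  have "le_U (heat e (K_delta j e (S_plus j e v (Suc n)))) (heat e (K_delta j e (heat a (K_delta j a v))))"
    using IH Qa S_plus_props[OF ve, of "Suc n"] pos e by (intro heat_K_delta_mono) auto
  also have "le_U \<dots> (heat e (heat a (K_delta j e (K_delta j a v))))"
    using U Qa va pos e by (intro heat_mono K_delta_heat_le in_U_heat in_U_K_delta) auto
  also have "le_U \<dots> (heat (a + e) (K_delta j e (K_delta j a v)))"
    by (rule le_U_of_Fm_eq) (use U e pos in \<open>simp add: Fm_heat_heat add.commute\<close>)
  also have "le_U \<dots> (heat (a + e) (K_delta j (a + e) v))"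
    using U v pos e by (intro heat_mono le_U_of_Fm_eq) (auto simp: Fm_K_delta_K_delta)
  finally show ?case unfolding sum by simp
qed simp

text \<open>The coarse step is first applied to the fine barrier, by monotonicity, and then compared
  with \<open>k\<close> fine steps from there.\<close>

lemma S_minus_refine:
  assumes u: "in_U u" and j: "0 < j" and e: "0 < e" and k: "0 < k" and M: "j * (real k * e) < Fm u 0"
  shows "le_U (S_minus j (real k * e) u m) (S_minus j e u (m * k))"
proof (induction m)
  case (Suc m)
  have pos: "0 < real k * e" "0 < j * e" "0 < j * (real k * e)" using j e k by auto
  have "1 * (j * e) \<le> real k * (j * e)" using k pos by (intro mult_right_mono) auto
  hence M': "j * e < Fm u 0" using M by (simp add: mult_ac)
  note c = S_minus_props[OF u pos(3,1) M, of m]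
  note f = S_minus_props[OF u pos(2) e M', of "m * k"]
  obtain n where n: "k = Suc n" using k gr0_implies_Suc by blast
  have "le_U (S_minus j (real k * e) u (Suc m)) (K_delta j (real k * e) (heat (real k * e) (S_minus j e u (m * k))))"
    using Suc c f pos M by (auto intro!: K_delta_heat_mono)
  also have "le_U \<dots> (S_minus j e (S_minus j e u (m * k)) k)"
    using f M unfolding n by (intro K_delta_heat_le_S_minus j e) auto
  finally show ?case by (simp add: S_minus_add[symmetric] add.commute)
qed simp

text \<open>Here the comparison with \<open>k\<close> fine steps comes first and monotonicity
  second; \<open>S_plus_in_U_delta\<close> makes the coarse cut admissible on the fine
  barrier.\<close>

lemma S_plus_refine:
  assumes j: "0 < j" and e: "0 < e" and k: "0 < k" and u: "in_U_delta j (real k * e) u"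
  shows "le_U (S_plus j e u (m * k)) (S_plus j (real k * e) u m)"
proof (induction m)
  case (Suc m)
  have pos: "0 < real k * e" "0 < j * e" "0 < j * (real k * e)" using j e k by auto
  have "1 * (j * e) \<le> real k * (j * e)" using k pos by (intro mult_right_mono) auto
  hence ue: "in_U_delta j e u" using u by (auto simp: in_U_delta_def mult_ac)
  have c: "in_U_delta j (real k * e) (S_plus j (real k * e) u m)"
    using S_plus_props[OF u pos(3,1)] by blast
  have f: "in_U_delta j (real k * e) (S_plus j e u (m * k))"
    by (rule S_plus_in_U_delta[OF ue pos(2) e u])
  obtain n where n: "k = Suc n" using k gr0_implies_Suc by blast
  have "le_U (S_plus j e (S_plus j e u (m * k)) k)
      (heat (real k * e) (K_delta j (real k * e) (S_plus j e u (m * k))))"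
    using f unfolding n by (intro S_plus_le_heat_K_delta j e)
  also have "le_U \<dots> (S_plus j (real k * e) u (Suc m))"
    using Suc c f pos by (auto intro!: heat_K_delta_mono)
  finally show ?case by (simp add: S_plus_add[symmetric] add.commute)
qed simp

text \<open>Barriers are indexed by the number of steps: time \<open>m * \<delta>\<close> is step
  \<open>m\<close> of a coarse barrier and step \<open>m * k\<close> of a fine one.\<close>

theorem mainTheorem10:
  fixes j \<delta> :: real and \<rho> :: "real \<Rightarrow> real" and k :: nat
  assumes "j > 0" and "Linf_nonneg \<rho>" and "Fm (0, \<rho>) 0 > 0"
    and "\<delta> > 0" and "j * \<delta> < Fm (0, \<rho>) 0" and "k > 0"
  shows "(\<forall>m::nat.
            le_U (S_minus j \<delta> (0, \<rho>) m) (S_minus j (\<delta> / real k) (0, \<rho>) (m * k)) \<and>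
            le_U (S_minus j (\<delta> / real k) (0, \<rho>) (m * k)) (S_plus j (\<delta> / real k) (0, \<rho>) (m * k)) \<and>
            le_U (S_plus j (\<delta> / real k) (0, \<rho>) (m * k)) (S_plus j \<delta> (0, \<rho>) m))
       \<and> (\<forall>d > 0. \<forall>v w. in_U_delta j d v \<longrightarrow> in_U_delta j d w \<longrightarrow> le_U v w \<longrightarrow>
            le_U (K_delta j d v) (K_delta j d w) \<and>
            (\<forall>t > 0. le_U (heat t v) (heat t w)) \<and>
            (\<forall>n. le_U (S_minus j d v n) (S_minus j d w n) \<and> le_U (S_plus j d v n) (S_plus j d w n)))"
proof (intro conjI allI impI)
  define e where "e = \<delta> / real k"
  have e: "0 < e" "\<delta> = real k * e" using assms by (auto simp: e_def)
  have u: "in_U (0, \<rho>)" "in_U_delta j \<delta> (0, \<rho>)" using assms by (auto simp: in_U_def in_U_delta_def)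
  \<comment> \<open>As \<open>k \<ge> 1\<close>, a measure that admits the coarse cut admits the
    fine one.\<close>
  have "1 * (j * e) \<le> real k * (j * e)" using assms e(1) by (intro mult_right_mono) auto
  hence "j * e \<le> j * \<delta>" unfolding e(2) by (simp only: mult_1 mult.left_commute)
  hence ue: "in_U_delta j e (0, \<rho>)" using u by (auto simp: in_U_delta_def)
  fix m
  show "le_U (S_minus j \<delta> (0, \<rho>) m) (S_minus j (\<delta> / real k) (0, \<rho>) (m * k))"
    using S_minus_refine[OF u(1) assms(1) e(1) assms(6), of m] assms(5) unfolding e_def[symmetric] unfolding e(2) .
  show "le_U (S_minus j (\<delta> / real k) (0, \<rho>) (m * k)) (S_plus j (\<delta> / real k) (0, \<rho>) (m * k))"
    unfolding e_def[symmetric] using assms e(1) ue by (intro S_minus_le_S_plus) auto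
  show "le_U (S_plus j (\<delta> / real k) (0, \<rho>) (m * k)) (S_plus j \<delta> (0, \<rho>) m)"
    using S_plus_refine[OF assms(1) e(1) assms(6), of _ m] u(2) unfolding e_def[symmetric] unfolding e(2) .
next
  fix d v w assume *: "0 < d" "in_U_delta j d v" "in_U_delta j d w" "le_U v w"
  have jd: "0 < j * d" using * assms by simp
  show "le_U (K_delta j d v) (K_delta j d w)" using * jd by (intro K_delta_mono)
  show "le_U (heat t v) (heat t w)" if "0 < t" for t
    using * that by (intro heat_mono) (auto dest: in_U_delta_in_U)
  show "le_U (S_minus j d v n) (S_minus j d w n)" "le_U (S_plus j d v n) (S_plus j d w n)" for n
    using * jd by (auto intro!: S_minus_mono S_plus_mono)
qed

end
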